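(* Let $X$ and $Y$ be complex Banach spaces and let $HV(X)$, $HV(Y)$ be the algebras of holomorphic functions of zero exponential type. If $HV(X)\cong HV(Y)$ as topological algebras, then $X^*\cong Y^*$. If moreover both $X$ and $Y$ are symmetrically regular or $X$ is regular, then $HV(X)\cong HV(Y)$ as topological algebras if and only if $X^*\cong Y^*$.
   Context: For a complex Banach space $X$, let $v(x)=e^{-\|x\|}$ and $V=\{v^{1/n}\}_{n\ge1}$. Then $$HV(X)=\{f:X\to\mathbb C\text{ holomorphic}:\ \sup_{x\in X}e^{-\|x\|/n}|f(x)|<\infty\ \text{for all }n\ge1\},$$ endowed with the Fréchet topology defined by the seminorms $\|f\|_{v^{1/n}}=\sup_{x}e^{-\|x\|/n}|f(x)|$ and with pointwise multiplication. An isomorphism of topological algebras is a bijective algebra homomorphism that is a homeomorphism; $X^*\cong Y^*$ means linear homeomorphism of the dual Banach spaces. $X$ is regular (respectively, symmetrically regular) if every continuous linear $T:X\to X^*$ (respectively, every continuous linear $T:X\to X^*$ that is symmetric, i.e. $Tx_1(x_2)=Tx_2(x_1)$ for all $x_1,x_2\in X$) is weakly compact. *)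

theory Defs
  imports "HOL-Analysis.Analysis"
begin

section \<open>Complex Banach spaces\<close>

class complex_normed_vector = real_normed_vector +
  fixes scaleC :: "complex \<Rightarrow> 'a \<Rightarrow> 'a" (infixr "*\<^sub>C" 75)
  assumes scaleC_add_right: "c *\<^sub>C (x + y) = c *\<^sub>C x + c *\<^sub>C y"
    and scaleC_add_left: "(c + d) *\<^sub>C x = c *\<^sub>C x + d *\<^sub>C x"
    and scaleC_scaleC: "c *\<^sub>C d *\<^sub>C x = (c * d) *\<^sub>C x"
    and scaleC_of_real: "complex_of_real r *\<^sub>C x = r *\<^sub>R x"
    and norm_scaleC: "norm (c *\<^sub>C x) = norm c * norm x"

class complex_banach = complex_normed_vector + complete_space

subclass (in complex_banach) banach ..

lemma vector_space_scaleC: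
  "vector_space (scaleC :: complex \<Rightarrow> 'a \<Rightarrow> 'a::complex_normed_vector)"
proof
  show "1 *\<^sub>C x = x" for x :: 'a
    using scaleC_of_real[of 1 x] by simp
qed (simp_all add: scaleC_add_right scaleC_add_left scaleC_scaleC)

instantiation complex :: complex_banach
begin

definition scaleC_complex_def: "c *\<^sub>C (z::complex) = c * z"

instance
  by standard (simp_all add: scaleC_complex_def algebra_simps norm_mult scaleR_conv_of_real)

end

abbreviation clinear :: "('a::complex_normed_vector \<Rightarrow> 'b::complex_normed_vector) \<Rightarrow> bool"
  where "clinear \<equiv> Vector_Spaces.linear scaleC scaleC"

lemma clinear_iff:
  "clinear T \<longleftrightarrow> (\<forall>x y. T (x + y) = T x + T y) \<and> (\<forall>c x. T (c *\<^sub>C x) = c *\<^sub>C T x)"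
proof -
  have "module (scaleC :: complex \<Rightarrow> 'a \<Rightarrow> 'a)" "module (scaleC :: complex \<Rightarrow> 'b \<Rightarrow> 'b)"
    by (simp_all add: module_iff_vector_space vector_space_scaleC)
  then show ?thesis
    by (simp add: linear_iff_module_hom module_hom_iff)
qed

lemma scaleC_zero_right [simp]: "c *\<^sub>C 0 = (0::'a::complex_normed_vector)"
  using scaleC_add_right[of c 0 "0::'a"] by simp


section \<open>The dual Banach space\<close>

text \<open>
  The type \<open>'a \<Rightarrow>\<^sub>L complex\<close> consists of all bounded real-linear maps; the dual is its
  complex-linear part, with the (inherited) operator norm.
\<close>

typedef (overloaded) ('a::complex_normed_vector) cdual =
  "{\<phi> :: 'a \<Rightarrow>\<^sub>L complex. clinear (blinfun_apply \<phi>)}"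
  morphisms blinfun_of_cdual Abs_cdual
  by (rule exI[of _ 0]) (simp add: clinear_iff)

setup_lifting type_definition_cdual

definition cdual_apply :: "'a::complex_normed_vector cdual \<Rightarrow> 'a \<Rightarrow> complex"
  where "cdual_apply \<phi> = blinfun_apply (blinfun_of_cdual \<phi>)"

instantiation cdual :: (complex_normed_vector) complex_normed_vector
begin

lift_definition zero_cdual :: "'a cdual" is 0
  by (simp add: clinear_iff)
lift_definition plus_cdual :: "'a cdual \<Rightarrow> 'a cdual \<Rightarrow> 'a cdual" is "(+)"
  by (simp add: clinear_iff plus_blinfun.rep_eq scaleC_add_right)
lift_definition minus_cdual :: "'a cdual \<Rightarrow> 'a cdual \<Rightarrow> 'a cdual" is "(-)"
  by (simp add: clinear_iff minus_blinfun.rep_eq scaleC_complex_def algebra_simps)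
lift_definition uminus_cdual :: "'a cdual \<Rightarrow> 'a cdual" is uminus
  by (simp add: clinear_iff uminus_blinfun.rep_eq scaleC_complex_def)
lift_definition scaleR_cdual :: "real \<Rightarrow> 'a cdual \<Rightarrow> 'a cdual" is "(*\<^sub>R)"
  by (simp add: clinear_iff scaleR_blinfun.rep_eq scaleC_complex_def algebra_simps)
lift_definition norm_cdual :: "'a cdual \<Rightarrow> real" is norm .
lift_definition scaleC_cdual :: "complex \<Rightarrow> 'a cdual \<Rightarrow> 'a cdual"
  is "\<lambda>c \<phi>. Blinfun (\<lambda>x. c * blinfun_apply \<phi> x)"
proof -
  fix c :: complex and \<phi> :: "'a \<Rightarrow>\<^sub>L complex"
  assume "clinear (blinfun_apply \<phi>)"
  moreover have "bounded_linear (\<lambda>x. c * blinfun_apply \<phi> x)"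
    by (intro bounded_linear_intros)
  ultimately show "clinear (blinfun_apply (Blinfun (\<lambda>x. c * blinfun_apply \<phi> x)))"
    by (simp add: bounded_linear_Blinfun_apply clinear_iff scaleC_complex_def algebra_simps)
qed

definition dist_cdual :: "'a cdual \<Rightarrow> 'a cdual \<Rightarrow> real"
  where "dist_cdual \<phi> \<psi> = norm (\<phi> - \<psi>)"
definition sgn_cdual :: "'a cdual \<Rightarrow> 'a cdual"
  where "sgn_cdual \<phi> = inverse (norm \<phi>) *\<^sub>R \<phi>"
definition uniformity_cdual :: "('a cdual \<times> 'a cdual) filter"
  where "uniformity_cdual = (INF e\<in>{0<..}. principal {(\<phi>, \<psi>). dist \<phi> \<psi> < e})"
definition open_cdual :: "'a cdual set \<Rightarrow> bool"
  where "open_cdual U \<longleftrightarrow> (\<forall>\<phi>\<in>U. eventually (\<lambda>(\<phi>', \<psi>). \<phi>' = \<phi> \<longrightarrow> \<psi> \<in> U) uniformity)"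

lemma blinfun_apply_scaleC_cdual:
  "blinfun_apply (blinfun_of_cdual (c *\<^sub>C \<phi>)) x = c * blinfun_apply (blinfun_of_cdual \<phi>) x"
proof -
  have "bounded_linear (\<lambda>x. c * blinfun_apply (blinfun_of_cdual \<phi>) x)"
    by (intro bounded_linear_intros)
  then show ?thesis
    by (simp add: scaleC_cdual.rep_eq bounded_linear_Blinfun_apply)
qed

instance
proof
  fix \<phi> \<psi> \<xi> :: "'a cdual" and r s :: real and c d :: complex
  show "\<phi> + \<psi> + \<xi> = \<phi> + (\<psi> + \<xi>)" by transfer simp
  show "\<phi> + \<psi> = \<psi> + \<phi>" by transfer simp
  show "0 + \<phi> = \<phi>" by transfer simp
  show "- \<phi> + \<phi> = 0" by transfer simp
  show "\<phi> - \<psi> = \<phi> + - \<psi>" by transfer simp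
  show "r *\<^sub>R (\<phi> + \<psi>) = r *\<^sub>R \<phi> + r *\<^sub>R \<psi>" by transfer (simp add: algebra_simps)
  show "(r + s) *\<^sub>R \<phi> = r *\<^sub>R \<phi> + s *\<^sub>R \<phi>" by transfer (simp add: algebra_simps)
  show "r *\<^sub>R s *\<^sub>R \<phi> = (r * s) *\<^sub>R \<phi>" by transfer simp
  show "1 *\<^sub>R \<phi> = \<phi>" by transfer simp
  show "dist \<phi> \<psi> = norm (\<phi> - \<psi>)" by (rule dist_cdual_def)
  show "sgn \<phi> = inverse (norm \<phi>) *\<^sub>R \<phi>" by (rule sgn_cdual_def)
  show "uniformity = (INF e\<in>{0<..}. principal {(\<phi>, \<psi> :: 'a cdual). dist \<phi> \<psi> < e})"
    by (rule uniformity_cdual_def)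
  show "open U \<longleftrightarrow> (\<forall>\<phi>\<in>U. eventually (\<lambda>(\<phi>', \<psi>). \<phi>' = \<phi> \<longrightarrow> \<psi> \<in> U) uniformity)"
    for U :: "'a cdual set" by (rule open_cdual_def)
  show "(norm \<phi> = 0) = (\<phi> = 0)" by transfer simp
  show "norm (\<phi> + \<psi>) \<le> norm \<phi> + norm \<psi>" by transfer (rule norm_triangle_ineq)
  show "norm (r *\<^sub>R \<phi>) = \<bar>r\<bar> * norm \<phi>" by transfer simp
  have eqI: "\<alpha> = \<beta>" if "\<And>x. blinfun_apply (blinfun_of_cdual \<alpha>) x = blinfun_apply (blinfun_of_cdual \<beta>) x"
    for \<alpha> \<beta> :: "'a cdual"
    using that by (metis blinfun_eqI blinfun_of_cdual_inject)
  show "c *\<^sub>C (\<phi> + \<psi>) = c *\<^sub>C \<phi> + c *\<^sub>C \<psi>"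
    by (rule eqI) (simp add: blinfun_apply_scaleC_cdual plus_cdual.rep_eq plus_blinfun.rep_eq algebra_simps)
  show "(c + d) *\<^sub>C \<phi> = c *\<^sub>C \<phi> + d *\<^sub>C \<phi>"
    by (rule eqI) (simp add: blinfun_apply_scaleC_cdual plus_cdual.rep_eq plus_blinfun.rep_eq algebra_simps)
  show "c *\<^sub>C d *\<^sub>C \<phi> = (c * d) *\<^sub>C \<phi>"
    by (rule eqI) (simp add: blinfun_apply_scaleC_cdual)
  show "complex_of_real r *\<^sub>C \<phi> = r *\<^sub>R \<phi>"
    by (rule eqI) (simp add: blinfun_apply_scaleC_cdual scaleR_cdual.rep_eq scaleR_blinfun.rep_eq
        scaleR_conv_of_real)
  have le: "norm (a *\<^sub>C \<alpha>) \<le> norm a * norm \<alpha>" for a and \<alpha> :: "'a cdual"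
    unfolding norm_cdual.rep_eq
  proof (rule norm_blinfun_bound)
    fix x
    show "norm (blinfun_apply (blinfun_of_cdual (a *\<^sub>C \<alpha>)) x)
        \<le> norm a * norm (blinfun_of_cdual \<alpha>) * norm x"
      using mult_left_mono[OF norm_blinfun[of "blinfun_of_cdual \<alpha>" x], of "norm a"]
      by (simp add: blinfun_apply_scaleC_cdual norm_mult mult.assoc)
  qed simp
  show "norm (c *\<^sub>C \<phi>) = norm c * norm \<phi>"
  proof (cases "c = 0")
    case True
    then show ?thesis
      using le[of c \<phi>] by (simp add: norm_cdual.rep_eq)
  next
    case False
    have "(1 / c) *\<^sub>C c *\<^sub>C \<phi> = \<phi>"
      by (rule eqI) (simp add: blinfun_apply_scaleC_cdual False)
    then have "norm \<phi> \<le> norm (1 / c) * norm (c *\<^sub>C \<phi>)"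
      using le[of "1 / c" "c *\<^sub>C \<phi>"] by simp
    then have "norm c * norm \<phi> \<le> norm (c *\<^sub>C \<phi>)"
      using False by (simp add: norm_divide pos_le_divide_eq mult.commute)
    then show ?thesis
      using le[of c \<phi>] by simp
  qed
qed

end

lemma cdual_apply_zero: "cdual_apply 0 x = 0"
  and cdual_apply_add: "cdual_apply (\<phi> + \<psi>) x = cdual_apply \<phi> x + cdual_apply \<psi> x"
  and cdual_apply_diff: "cdual_apply (\<phi> - \<psi>) x = cdual_apply \<phi> x - cdual_apply \<psi> x"
  and cdual_apply_scaleC: "cdual_apply (c *\<^sub>C \<phi>) x = c * cdual_apply \<phi> x"
  by (simp_all add: cdual_apply_def zero_cdual.rep_eq plus_cdual.rep_eq plus_blinfun.rep_eq
      minus_cdual.rep_eq minus_blinfun.rep_eq blinfun_apply_scaleC_cdual)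

lemma norm_cdual_eq_onorm: "norm \<phi> = onorm (cdual_apply \<phi>)"
  by (simp add: cdual_apply_def norm_cdual.rep_eq norm_blinfun.rep_eq)

lemma cdual_eq_iff: "\<phi> = \<psi> \<longleftrightarrow> (\<forall>x. cdual_apply \<phi> x = cdual_apply \<psi> x)"
  by (metis blinfun_eqI blinfun_of_cdual_inject cdual_apply_def)

lemma range_cdual_apply: "range cdual_apply = {f. clinear f \<and> bounded_linear f}"
proof (intro equalityI subsetI)
  fix f :: "'a \<Rightarrow> complex"
  assume "f \<in> range cdual_apply"
  then obtain \<phi> where "f = blinfun_apply (blinfun_of_cdual \<phi>)"
    by (auto simp: cdual_apply_def)
  then show "f \<in> {f. clinear f \<and> bounded_linear f}"
    using blinfun_of_cdual[of \<phi>] by (simp add: blinfun.bounded_linear_right)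
next
  fix f :: "'a \<Rightarrow> complex"
  assume "f \<in> {f. clinear f \<and> bounded_linear f}"
  then have "f = cdual_apply (Abs_cdual (Blinfun f))"
    by (simp add: cdual_apply_def Abs_cdual_inverse bounded_linear_Blinfun_apply)
  then show "f \<in> range cdual_apply"
    by blast
qed

instance cdual :: (complex_normed_vector) complex_banach
proof
  fix X :: "nat \<Rightarrow> 'a cdual"
  assume "Cauchy X"
  have dist_eq: "dist \<phi> \<psi> = dist (blinfun_of_cdual \<phi>) (blinfun_of_cdual \<psi>)" for \<phi> \<psi> :: "'a cdual"
    by (simp add: dist_norm norm_cdual.rep_eq minus_cdual.rep_eq)
  from \<open>Cauchy X\<close> have "Cauchy (\<lambda>n. blinfun_of_cdual (X n))"
    by (simp add: Cauchy_def dist_eq)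
  then obtain L where L: "(\<lambda>n. blinfun_of_cdual (X n)) \<longlonglongrightarrow> L"
    using Cauchy_convergent convergent_def by blast
  have lim: "(\<lambda>n. blinfun_apply (blinfun_of_cdual (X n)) x) \<longlonglongrightarrow> blinfun_apply L x" for x
    by (intro tendsto_intros L)
  have hom: "blinfun_apply L (c *\<^sub>C x) = c * blinfun_apply L x" for c x
  proof (rule LIMSEQ_unique[OF lim])
    have "blinfun_apply (blinfun_of_cdual (X n)) (c *\<^sub>C x)
        = c * blinfun_apply (blinfun_of_cdual (X n)) x" for n
      using blinfun_of_cdual[of "X n"] by (simp add: clinear_iff scaleC_complex_def)
    then show "(\<lambda>n. blinfun_apply (blinfun_of_cdual (X n)) (c *\<^sub>C x))
        \<longlonglongrightarrow> c * blinfun_apply L x"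
      by (simp add: tendsto_mult_left lim)
  qed
  then have "blinfun_of_cdual (Abs_cdual L) = L"
    by (intro Abs_cdual_inverse) (simp add: clinear_iff scaleC_complex_def blinfun.add_right)
  with L have "X \<longlonglongrightarrow> Abs_cdual L"
    by (simp add: LIMSEQ_def dist_eq)
  then show "convergent X"
    by (rule convergentI)
qed

definition dual_isomorphic :: "'a::complex_normed_vector itself \<Rightarrow> 'b::complex_normed_vector itself \<Rightarrow> bool"
  where "dual_isomorphic _ _ \<longleftrightarrow>
    (\<exists>(T :: 'a cdual \<Rightarrow> 'b cdual) T'. clinear T \<and> homeomorphism UNIV UNIV T T')"


section \<open>Regularity\<close>

text \<open>On \<open>'a cdual\<close> this is the topology induced by the bidual \<open>'a cdual cdual\<close>, not the weak-star one.\<close>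

definition weak_topology :: "'a::complex_normed_vector topology"
  where "weak_topology =
    topology_generated_by {cdual_apply \<phi> -` U | (\<phi> :: 'a cdual) U. open U}"

lemma topspace_weak_topology [simp]: "topspace weak_topology = UNIV"
proof -
  have "UNIV \<in> {cdual_apply \<phi> -` U | (\<phi> :: 'a cdual) U. open U}"
    using open_UNIV by blast
  then show ?thesis
    unfolding weak_topology_def topology_generated_by_topspace by blast
qed

definition weakly_compact_op ::
    "('a::complex_normed_vector \<Rightarrow> 'b::complex_normed_vector) \<Rightarrow> bool"
  where "weakly_compact_op T \<longleftrightarrow>
    compactin weak_topology (weak_topology closure_of (T ` cball 0 1))"

definition regular_banach :: "'a::complex_banach itself \<Rightarrow> bool"
  where "regular_banach _ \<longleftrightarrow>
    (\<forall>T :: 'a \<Rightarrow> 'a cdual. clinear T \<and> continuous_on UNIV T \<longrightarrow> weakly_compact_op T)"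

definition symmetrically_regular_banach :: "'a::complex_banach itself \<Rightarrow> bool"
  where "symmetrically_regular_banach _ \<longleftrightarrow>
    (\<forall>T :: 'a \<Rightarrow> 'a cdual. clinear T \<and> continuous_on UNIV T
       \<and> (\<forall>x y. cdual_apply (T x) y = cdual_apply (T y) x) \<longrightarrow> weakly_compact_op T)"


section \<open>Holomorphic functions of zero exponential type\<close>

definition holomorphic_fun :: "('a::complex_normed_vector \<Rightarrow> complex) \<Rightarrow> bool"
  where "holomorphic_fun f \<longleftrightarrow> (\<forall>x. \<exists>D. clinear D \<and> (f has_derivative D) (at x))"

definition HV :: "('a::complex_normed_vector \<Rightarrow> complex) set"
  where "HV = {f. holomorphic_fun f \<and>
    (\<forall>n::nat\<ge>1. bdd_above (range (\<lambda>x. exp (- norm x / real n) * norm (f x))))}"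

definition HV_seminorm :: "nat \<Rightarrow> ('a::complex_normed_vector \<Rightarrow> complex) \<Rightarrow> real"
  where "HV_seminorm n f = (SUP x. exp (- norm x / real n) * norm (f x))"

definition HV_topology :: "('a::complex_normed_vector \<Rightarrow> complex) topology"
  where "HV_topology = topology_generated_by
    {{g \<in> HV. HV_seminorm n (\<lambda>x. g x - f x) < e} | f n e. f \<in> HV \<and> 1 \<le> n \<and> 0 < e}"

lemma topspace_HV_topology [simp]: "topspace HV_topology = (HV :: ('a::complex_normed_vector \<Rightarrow> complex) set)"
proof
  show "topspace HV_topology \<subseteq> (HV :: ('a::complex_normed_vector \<Rightarrow> complex) set)"
    unfolding HV_topology_def topology_generated_by_topspace by blast
  show "(HV :: ('a::complex_normed_vector \<Rightarrow> complex) set) \<subseteq> topspace HV_topology"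
  proof
    fix f :: "'a \<Rightarrow> complex"
    assume f: "f \<in> HV"
    let ?B = "{g \<in> HV. HV_seminorm 1 (\<lambda>x. g x - f x) < 1}"
    have "f \<in> ?B"
      using f by (simp add: HV_seminorm_def)
    moreover have "?B \<in> {{g \<in> HV. HV_seminorm n (\<lambda>x. g x - f x) < e} | f n e.
        f \<in> HV \<and> 1 \<le> n \<and> 0 < e}"
      using f by (intro CollectI exI[of _ f] exI[of _ "1::nat"] exI[of _ "1::real"]) simp
    ultimately show "f \<in> topspace HV_topology"
      unfolding HV_topology_def topology_generated_by_topspace by blast
  qed
qed

text \<open>
  An isomorphism of topological algebras.  Preservation of the constant function \<open>1\<close> is automatic
  for a multiplicative bijection.
\<close>

definition HV_iso :: "(('a::complex_normed_vector \<Rightarrow> complex) \<Rightarrow> ('b::complex_normed_vector \<Rightarrow> complex)) \<Rightarrow> bool"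
  where "HV_iso \<Phi> \<longleftrightarrow>
    bij_betw \<Phi> HV HV \<and>
    (\<forall>f\<in>HV. \<forall>g\<in>HV. \<Phi> (\<lambda>x. f x + g x) = (\<lambda>y. \<Phi> f y + \<Phi> g y)) \<and>
    (\<forall>c. \<forall>f\<in>HV. \<Phi> (\<lambda>x. c * f x) = (\<lambda>y. c * \<Phi> f y)) \<and>
    (\<forall>f\<in>HV. \<forall>g\<in>HV. \<Phi> (\<lambda>x. f x * g x) = (\<lambda>y. \<Phi> f y * \<Phi> g y)) \<and>
    homeomorphic_map HV_topology HV_topology \<Phi>"

definition HV_isomorphic :: "'a::complex_normed_vector itself \<Rightarrow> 'b::complex_normed_vector itself \<Rightarrow> bool"
  where "HV_isomorphic _ _ \<longleftrightarrow>
    (\<exists>\<Phi> :: ('a \<Rightarrow> complex) \<Rightarrow> ('b \<Rightarrow> complex). HV_iso \<Phi>)"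

end

theory Submission
  imports Defs "HOL-Complex_Analysis.Cauchy_Integral_Formula"
begin

text \<open>
  From an isomorphism \<open>\<Phi>\<close> to the duals: continuity of \<open>\<Phi>\<close> tested on the powers \<open>\<gamma>\<^sup>k\<close> of a functional
  shows that \<open>\<Phi> \<gamma>\<close> grows at most linearly, so it is affine by Liouville's theorem, and its linear part
  depends on \<open>\<gamma>\<close> through an isomorphism of the duals.

  Conversely, each \<open>z\<close> in the bidual acts on HV by the derivation \<open>D\<^sub>z f(x) = z(df(x))\<close>, which by Cauchy's
  estimate is bounded by \<open>e norm z / m\<close> in the \<open>m\<close>-th seminorm.  Symmetric regularity says exactly that
  these derivations commute.  The Aron-Berner extension is \<open>f(z) = (exp D\<^sub>z f)(0)\<close>: it is multiplicative
  as \<open>D\<^sub>z\<close> is a derivation, and commutation gives the translation formula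
  \<open>f(z + w) = \<Sum> (D\<^sub>w\<^sup>l f)(z) / l!\<close>, hence holomorphy.  Composing the extension with the restriction to \<open>Y\<close> of
  the adjoint of \<open>S: X* \<rightarrow> Y*\<close> gives a map HV(X) to HV(Y) that intertwines \<open>D\<^sub>w\<close> with the derivation along
  the adjoint image of \<open>w\<close>; therefore the map built from the inverse of \<open>S\<close> undoes it.

  If only \<open>X\<close> is assumed regular, a bilinear form on \<open>Y\<close> is transferred to \<open>X\<close> through its extension to
  the biduals, and regularity of \<open>X\<close> makes the two iterated extensions of the form agree.
\<close>

section \<open>Complex-linear maps and a criterion for differentiability\<close>

lemma scaleC_one [simp]: "1 *\<^sub>C x = (x::'a::complex_normed_vector)"
  using scaleC_of_real[of 1 x] by simp

lemma scaleC_zero_left [simp]: "0 *\<^sub>C x = (0::'a::complex_normed_vector)"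
  using scaleC_of_real[of 0 x] by simp

lemma bounded_linear_scaleC_left: "bounded_linear (\<lambda>s. s *\<^sub>C (u::'a::complex_normed_vector))"
proof (rule bounded_linear_intro[where K = "norm u"])
  show "(r *\<^sub>R s) *\<^sub>C u = r *\<^sub>R s *\<^sub>C u" for r s
    by (metis scaleC_of_real scaleC_scaleC scaleR_conv_of_real)
qed (simp_all add: scaleC_add_left norm_scaleC)

lemma clinearI:
  assumes "\<And>x y. T (x + y) = T x + T y" "\<And>c x. T (c *\<^sub>C x) = c *\<^sub>C T x"
  shows "clinear T"
  using assms by (simp add: clinear_iff)

lemma clinear_add: "clinear T \<Longrightarrow> T (x + y) = T x + T y"
  and clinear_scaleC: "clinear T \<Longrightarrow> T (c *\<^sub>C x) = c *\<^sub>C T x"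
  by (simp_all add: clinear_iff)

lemma clinear_zero: "clinear T \<Longrightarrow> T 0 = 0"
  by (metis clinear_add add_cancel_left_right)

lemma clinear_scaleR: "clinear T \<Longrightarrow> T (r *\<^sub>R x) = r *\<^sub>R T x"
  by (metis clinear_scaleC scaleC_of_real)

lemma clinear_diff: "clinear T \<Longrightarrow> T (x - y) = T x - T y"
  by (metis clinear_add eq_diff_eq)

lemma clinear_bounded:
  assumes "clinear T" "\<And>x. norm (T x) \<le> K * norm x"
  shows "bounded_linear T"
  using assms by (intro bounded_linear_intro[where K = K])
    (simp_all add: clinear_add clinear_scaleR mult.commute)

lemma clinear_continuous_bounded:
  assumes T: "clinear T" and cont: "continuous_on UNIV T"
  shows "bounded_linear T"
proof -
  obtain d where d: "d > 0" "\<And>x. norm x < d \<Longrightarrow> norm (T x) < 1"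
    using cont[unfolded continuous_on_iff, rule_format, of 0 1]
    by (auto simp: dist_norm clinear_zero[OF T])
  have "norm (T x) \<le> (2 / d) * norm x" for x
  proof (cases "x = 0")
    case False
    define a where "a = d / (2 * norm x)"
    have a: "a > 0" using d(1) False by (simp add: a_def)
    have "norm (a *\<^sub>R x) < d" using False d(1) by (simp add: a_def)
    then have "norm (T (a *\<^sub>R x)) < 1" by (rule d)
    then have "a * norm (T x) < 1" using a by (simp add: clinear_scaleR[OF T])
    then show ?thesis using False d(1) by (simp add: a_def field_simps)
  qed (simp add: clinear_zero[OF T])
  then show ?thesis using T by (rule clinear_bounded[rotated])
qed

text \<open>A second-order remainder divided by \<open>norm h\<close> is at most
  \<open>C * norm h\<close>. Taylor estimates arrive in this form, both for \<open>grad f\<close> in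
  \<open>has_derivative_of_grad\<close> and for \<open>transport\<close>.\<close>

lemma has_derivative_quadratic_remainder:
  fixes f :: "'a::real_normed_vector \<Rightarrow> 'b::real_normed_vector"
  assumes D: "bounded_linear D" and d: "d > 0"
    and rem: "\<And>h. norm h \<le> d \<Longrightarrow> norm (f (x + h) - f x - D h) \<le> C * norm h ^ 2"
  shows "(f has_derivative D) (at x)"
  unfolding has_derivative_at
proof (intro conjI D)
  have lim: "((\<lambda>h::'a. C * norm h) \<longlongrightarrow> 0) (at 0)"
    by (intro tendsto_mult_right_zero tendsto_norm_zero tendsto_ident_at)
  have "\<forall>\<^sub>F h in at 0. norm (norm (f (x + h) - f x - D h) / norm h) \<le> C * norm h"
    unfolding eventually_at
  proof (intro exI[of _ d] conjI d ballI impI)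
    fix h :: 'a
    assume h: "h \<noteq> 0 \<and> dist h 0 < d"
    then show "norm (norm (f (x + h) - f x - D h) / norm h) \<le> C * norm h"
      using rem[of h] by (simp add: divide_le_eq power2_eq_square mult.assoc)
  qed
  then show "((\<lambda>h. norm (f (x + h) - f x - D h) / norm h) \<longlongrightarrow> 0) (at 0)"
    by (rule Lim_null_comparison[OF _ lim])
qed


section \<open>Entire functions of one variable\<close>

lemma entire_Cauchy_estimate:
  assumes p: "p holomorphic_on UNIV" and R: "R > 0"
    and M: "\<And>s. norm s \<le> R \<Longrightarrow> norm (p s) \<le> M"
  shows "norm ((deriv ^^ n) p 0) \<le> fact n * M / R ^ n"
  using Cauchy_inequality[of p 0 R M n] assms
  by (auto intro: holomorphic_on_subset holomorphic_on_imp_continuous_on)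

lemma entire_deriv_bound:
  fixes p :: "complex \<Rightarrow> complex"
  assumes p: "\<And>s. (p has_field_derivative p' s) (at s)" and R: "R > 0"
    and M: "\<And>s. norm s \<le> R \<Longrightarrow> norm (p s) \<le> M"
  shows "norm (p' 0) \<le> M / R"
proof -
  have "p holomorphic_on UNIV" using p by (auto simp: holomorphic_on_open)
  from entire_Cauchy_estimate[OF this R M, of 1] show ?thesis
    using DERIV_imp_deriv[OF p[of 0]] by simp
qed

text \<open>The remainder is a tail of the Taylor series at 0. Cauchy's estimates bound its terms by
  \<open>M * x ^ n\<close> with \<open>x = norm t / R\<close>, and \<open>x \<le> 1 / 2\<close>
  bounds the factor \<open>1 / (1 - x)\<close> of the geometric sum by 2.\<close>

lemma entire_linear_remainder:
  fixes p :: "complex \<Rightarrow> complex"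
  assumes p: "\<And>s. (p has_field_derivative p' s) (at s)" and R: "R > 0"
    and M: "\<And>s. norm s \<le> R \<Longrightarrow> norm (p s) \<le> M" and t: "norm t \<le> R / 2"
  shows "norm (p t - p 0 - t * p' 0) \<le> 2 * M * (norm t / R) ^ 2"
proof -
  have hol: "p holomorphic_on UNIV" using p by (auto simp: holomorphic_on_open)
  define a where "a n = (deriv ^^ n) p 0 / fact n * t ^ n" for n
  define x where "x = norm t / R"
  have M0: "M \<ge> 0" using M[of 0] R norm_ge_zero order_trans by (metis norm_zero less_imp_le)
  have x: "0 \<le> x" "x \<le> 1 / 2" using t R by (auto simp: x_def field_simps)
  have "a sums p t"
    using holomorphic_power_series[OF holomorphic_on_subset[OF hol], of 0 "norm t + 1" t]
    by (simp add: a_def[abs_def])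
  then have "(\<lambda>n. a (n + 2)) sums (p t - sum a {..<2})"
    by (rule sums_split_initial_segment)
  moreover have "sum a {..<2} = p 0 + t * p' 0"
    using DERIV_imp_deriv[OF p[of 0]] by (simp add: a_def numeral_2_eq_2 lessThan_Suc)
  ultimately have s: "(\<lambda>n. a (n + 2)) sums (p t - p 0 - t * p' 0)" by (simp add: algebra_simps)
  have an: "norm (a n) \<le> M * x ^ n" for n
  proof -
    have "norm (a n) = norm ((deriv ^^ n) p 0) / fact n * norm t ^ n"
      by (simp add: a_def norm_mult norm_divide norm_power)
    also have "\<dots> \<le> (fact n * M / R ^ n) / fact n * norm t ^ n"
      by (intro mult_right_mono divide_right_mono entire_Cauchy_estimate[OF hol R M]) auto
    also have "\<dots> = M * x ^ n" by (simp add: x_def power_divide)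
    finally show ?thesis .
  qed
  have g: "(\<lambda>n. M * x ^ 2 * x ^ n) sums (M * x ^ 2 * (1 / (1 - x)))"
    using x by (intro sums_mult geometric_sums) auto
  have "norm (p t - p 0 - t * p' 0) = norm (\<Sum>n. a (n + 2))" using s by (simp add: sums_iff)
  also have "\<dots> \<le> (\<Sum>n. M * x ^ 2 * x ^ n)"
  proof (rule norm_suminf_le)
    show "norm (a (n + 2)) \<le> M * x ^ 2 * x ^ n" for n
      using an[of "n + 2"] by (simp add: power_add power2_eq_square mult_ac)
  qed (use g sums_summable in blast)
  also have "\<dots> = M * x ^ 2 * (1 / (1 - x))" using g by (simp add: sums_iff)
  also have "\<dots> \<le> M * x ^ 2 * 2"
    using x M0 by (intro mult_left_mono) (auto simp: field_simps)
  finally show ?thesis by (simp add: x_def)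
qed

lemma entire_linear_growth_affine:
  fixes p :: "complex \<Rightarrow> complex"
  assumes p: "\<And>s. (p has_field_derivative p' s) (at s)"
    and K: "\<And>s. norm (p s) \<le> A + B * norm s"
  shows "p s = p 0 + s * p' 0"
proof -
  have hol: "p holomorphic_on UNIV" using p by (auto simp: holomorphic_on_open)
  \<comment> \<open>\<open>Liouville_polynomial\<close> takes a pure power bound away from the
    origin, so for \<open>1 \<le> norm z\<close> the constant is absorbed into the linear
    term.\<close>
  have "norm (p z) \<le> (\<bar>A\<bar> + B) * norm z ^ 1" if "1 \<le> norm z" for z
  proof -
    have "A \<le> \<bar>A\<bar> * norm z"
      using mult_left_mono[OF that, of "\<bar>A\<bar>"] by simp
    then show ?thesis using K[of z] by (simp add: distrib_right)
  qed
  from Liouville_polynomial[OF hol this, where \<xi> = s] show ?thesis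
    using DERIV_imp_deriv[OF p[of 0]] by simp
qed


section \<open>Functionals and operators\<close>

text \<open>A total inverse of \<open>cdual_apply\<close>, meaningful on its range, which by
  \<open>range_cdual_apply\<close> consists of the bounded complex-linear functions.\<close>

definition cdual_of :: "('a::complex_normed_vector \<Rightarrow> complex) \<Rightarrow> 'a cdual"
  where "cdual_of f = inv cdual_apply f"

lemma cdual_apply_of [simp]:
  assumes "clinear f" "bounded_linear f"
  shows "cdual_apply (cdual_of f) = f"
  unfolding cdual_of_def using assms range_cdual_apply by (intro f_inv_into_f) blast

lemma clinear_cdual_apply: "clinear (cdual_apply \<phi>)"
  and bounded_linear_cdual_apply: "bounded_linear (cdual_apply \<phi>)"
  using range_cdual_apply rangeI[of cdual_apply \<phi>] by auto

lemma cdual_apply_arg_scaleC: "cdual_apply \<phi> (c *\<^sub>C x) = c * cdual_apply \<phi> x"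
  using clinear_scaleC[OF clinear_cdual_apply] by (simp add: scaleC_complex_def)

lemmas cdual_apply_arg_add = clinear_add[OF clinear_cdual_apply]
  and cdual_apply_arg_diff = clinear_diff[OF clinear_cdual_apply]
  and cdual_apply_arg_zero [simp] = clinear_zero[OF clinear_cdual_apply]
  and cdual_apply_arg_scaleR = clinear_scaleR[OF clinear_cdual_apply]

lemma cdual_bound: "norm (cdual_apply \<phi> x) \<le> norm \<phi> * norm x"
  using onorm[OF bounded_linear_cdual_apply] by (simp add: norm_cdual_eq_onorm)

lemma cdual_norm_le:
  assumes "0 \<le> K" "\<And>x. norm (cdual_apply \<phi> x) \<le> K * norm x"
  shows "norm \<phi> \<le> K"
  unfolding norm_cdual_eq_onorm using assms by (rule onorm_bound)

lemma cdual_apply_clinear_left: "clinear (\<lambda>\<phi>. cdual_apply \<phi> x)"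
  by (rule clinearI) (simp_all add: cdual_apply_add cdual_apply_scaleC scaleC_complex_def)

lemma cdual_apply_bounded_left: "bounded_linear (\<lambda>\<phi>. cdual_apply \<phi> x)"
  by (rule clinear_bounded[OF cdual_apply_clinear_left, of _ "norm x"])
    (metis cdual_bound mult.commute)

text \<open>Multiplying the argument by a scalar of modulus 1 turns
  \<open>cdual_apply \<phi> x\<close> into a negative real, so a lower bound on real parts over the
  unit ball already controls the norm.\<close>

lemma cdual_norm_le_Re:
  assumes K: "\<And>x. norm x \<le> 1 \<Longrightarrow> - K \<le> Re (cdual_apply \<phi> x)"
  shows "norm \<phi> \<le> K"
proof (rule cdual_norm_le)
  show "0 \<le> K" using K[of 0] by simp
  fix x :: 'a
  define c where "c = cdual_apply \<phi> x"
  show "norm (cdual_apply \<phi> x) \<le> K * norm x"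
  proof (cases "c = 0")
    case True
    then show ?thesis using K[of 0] by (simp add: c_def)
  next
    case False
    then have x: "x \<noteq> 0" by (auto simp: c_def)
    define a where "a = - (cnj c / (norm c * norm x))"
    have "norm (a *\<^sub>C x) \<le> 1" using False x by (simp add: a_def norm_scaleC norm_divide norm_mult)
    then have "- K \<le> Re (cdual_apply \<phi> (a *\<^sub>C x))" by (rule K)
    also have "cdual_apply \<phi> (a *\<^sub>C x) = a * c" by (simp add: cdual_apply_arg_scaleC c_def)
    also have "a * c = - of_real (norm c / norm x)"
      using False x complex_norm_square[of c]
      by (simp add: a_def field_simps power2_eq_square)
    finally show ?thesis using x by (simp add: c_def field_simps)
  qed
qed

definition bidual_embed :: "'a::complex_normed_vector \<Rightarrow> 'a cdual cdual"
  where "bidual_embed x = cdual_of (\<lambda>\<phi>. cdual_apply \<phi> x)"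

lemma bidual_embed_apply [simp]: "cdual_apply (bidual_embed x) \<phi> = cdual_apply \<phi> x"
  by (simp add: bidual_embed_def cdual_apply_clinear_left cdual_apply_bounded_left)

text \<open>The adjoint of \<open>T\<close> at \<open>\<phi>\<close>. For \<open>T\<close> from a
  space to its dual it maps the bidual to the dual; for \<open>S\<close> between duals it maps
  between the biduals in the opposite direction.\<close>

definition precomp :: "'b::complex_normed_vector cdual \<Rightarrow> ('a::complex_normed_vector \<Rightarrow> 'b) \<Rightarrow> 'a cdual"
  where "precomp \<phi> T = cdual_of (\<lambda>x. cdual_apply \<phi> (T x))"

lemma precomp_apply [simp]:
  assumes "clinear T" "bounded_linear T"
  shows "cdual_apply (precomp \<phi> T) x = cdual_apply \<phi> (T x)"
proof -
  have "clinear (\<lambda>x. cdual_apply \<phi> (T x))"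
    using assms by (intro clinearI)
      (simp_all add: clinear_add clinear_scaleC cdual_apply_arg_add cdual_apply_arg_scaleC scaleC_complex_def)
  moreover have "bounded_linear (\<lambda>x. cdual_apply \<phi> (T x))"
    by (rule bounded_linear_compose[OF bounded_linear_cdual_apply assms(2)])
  ultimately show ?thesis by (simp add: precomp_def)
qed

section \<open>Gradients\<close>

definition grad :: "('a::complex_normed_vector \<Rightarrow> complex) \<Rightarrow> 'a \<Rightarrow> 'a cdual"
  where "grad f x = cdual_of (frechet_derivative f (at x))"

lemma grad_eqI:
  assumes "(f has_derivative cdual_apply \<phi>) (at x)"
  shows "grad f x = \<phi>"
proof -
  have "frechet_derivative f (at x) = cdual_apply \<phi>"
    using frechet_derivative_at[OF assms] by simp
  moreover have "cdual_of (cdual_apply \<phi>) = \<phi>"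
    by (simp add: cdual_eq_iff clinear_cdual_apply bounded_linear_cdual_apply)
  ultimately show ?thesis by (simp add: grad_def)
qed

lemma holomorphic_funI:
  assumes "\<And>x. (f has_derivative cdual_apply (\<phi> x)) (at x)"
  shows "holomorphic_fun f"
  using assms clinear_cdual_apply by (auto simp: holomorphic_fun_def)

lemma has_derivative_grad:
  assumes "holomorphic_fun f"
  shows "(f has_derivative cdual_apply (grad f x)) (at x)"
proof -
  obtain D where D: "clinear D" "(f has_derivative D) (at x)"
    using assms by (auto simp: holomorphic_fun_def)
  then have "bounded_linear D" by (simp add: has_derivative_bounded_linear)
  with D have "(f has_derivative cdual_apply (cdual_of D)) (at x)" by simp
  then show ?thesis using grad_eqI by metis
qed

lemma grad_line:
  assumes "holomorphic_fun f"
  shows "((\<lambda>s. f (x + s *\<^sub>C u)) has_field_derivative cdual_apply (grad f (x + s *\<^sub>C u)) u) (at s)"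
proof -
  have "((\<lambda>s. x + s *\<^sub>C u) has_derivative (\<lambda>s. 0 + s *\<^sub>C u)) (at s)"
    by (intro has_derivative_add has_derivative_const
        bounded_linear_imp_has_derivative bounded_linear_scaleC_left)
  from has_derivative_compose[OF this has_derivative_grad[OF assms]]
  show ?thesis
    by (simp add: has_field_derivative_def cdual_apply_arg_scaleC mult_commute_abs)
qed

text \<open>Cauchy's estimate on each complex line through \<open>x\<close>; the radius
  \<open>R / norm u\<close> in the parameter is the one that fills the ball of radius
  \<open>R\<close>.\<close>

lemma norm_grad_le:
  assumes f: "holomorphic_fun f" and R: "R > 0"
    and M: "\<And>y. norm (y - x) \<le> R \<Longrightarrow> norm (f y) \<le> M"
  shows "norm (grad f x) \<le> M / R"
proof (rule cdual_norm_le)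
  have "M \<ge> 0" using M[of x] R by (metis diff_self less_imp_le norm_ge_zero norm_zero order_trans)
  then show "0 \<le> M / R" using R by simp
  fix u :: 'a
  show "norm (cdual_apply (grad f x) u) \<le> M / R * norm u"
  proof (cases "u = 0")
    case False
    have "norm (cdual_apply (grad f (x + 0 *\<^sub>C u)) u) \<le> M / (R / norm u)"
    proof (rule entire_deriv_bound[OF grad_line[OF f]])
      show "norm (f (x + s *\<^sub>C u)) \<le> M" if "norm s \<le> R / norm u" for s
        using that False by (intro M) (simp add: norm_scaleC field_simps)
    qed (use R False in simp)
    then show ?thesis by simp
  qed simp
qed

section \<open>Second derivatives of holomorphic functions bounded on bounded sets\<close>

definition bounded_type :: "('a::complex_normed_vector \<Rightarrow> complex) \<Rightarrow> bool"
  where "bounded_type f \<longleftrightarrow>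
    holomorphic_fun f \<and> (\<forall>r. \<exists>M. \<forall>x. norm x \<le> r \<longrightarrow> norm (f x) \<le> M)"

lemma LIMSEQ_inverse_complex_Suc: "(\<lambda>n. 1 / of_nat (Suc n) :: complex) \<longlonglongrightarrow> 0"
  using LIMSEQ_Suc[OF lim_1_over_n[where 'a = complex]] by simp

lemma difference_quotient_sequence:
  fixes p :: "complex \<Rightarrow> complex"
  assumes "(p has_field_derivative c) (at 0)"
  shows "(\<lambda>n. (p (1 / of_nat (Suc n)) - p 0) / (1 / of_nat (Suc n))) \<longlonglongrightarrow> c"
proof -
  have "((\<lambda>h. (p (0 + h) - p 0) / h) \<longlongrightarrow> c) (at 0)" using assms by (simp add: DERIV_def)
  moreover have "filterlim (\<lambda>n. 1 / of_nat (Suc n) :: complex) (at 0) sequentially"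
    unfolding filterlim_at using LIMSEQ_inverse_complex_Suc by (auto simp: simp del: of_nat_Suc)
  ultimately show ?thesis by (auto dest: filterlim_compose)
qed

text \<open>The difference quotients \<open>\<Phi> n\<close> of \<open>f\<close> in direction
  \<open>k\<close> are entire in the parameter \<open>s\<close> along \<open>h\<close> and converge
  uniformly on the unit disc to \<open>p\<close>. By Weierstrass' theorem their derivatives
  \<open>\<Phi>' n\<close> converge to the derivative of \<open>p\<close>; at \<open>s = 0\<close>
  these are difference quotients in direction \<open>k\<close> of the \<open>h\<close>-derivative.
  So one number \<open>c\<close> is both mixed second derivatives.\<close>

lemma grad_line_derivative:
  assumes f: "bounded_type f"
  obtains c where "((\<lambda>s. cdual_apply (grad f (x + s *\<^sub>C h)) k) has_field_derivative c) (at 0)"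
    and "(\<lambda>n. (cdual_apply (grad f (x + (1 / of_nat (Suc n)) *\<^sub>C k)) h - cdual_apply (grad f x) h)
            / (1 / of_nat (Suc n))) \<longlonglongrightarrow> c"
proof -
  have hol: "holomorphic_fun f" using f by (simp add: bounded_type_def)
  \<comment> \<open>The radius leaves room for \<open>x + s *\<^sub>C h + \<tau> *\<^sub>C k\<close>
    with \<open>norm s \<le> 1\<close> and \<open>norm \<tau> \<le> 2\<close>.\<close>
  obtain M where M: "\<And>y. norm y \<le> norm x + norm h + 2 * norm k \<Longrightarrow> norm (f y) \<le> M"
    using f unfolding bounded_type_def by blast
  define t :: "nat \<Rightarrow> complex" where "t n = 1 / of_nat (Suc n)" for n
  have t: "t n \<noteq> 0" "norm (t n) \<le> 1" for n
    by (auto simp: t_def norm_divide simp del: of_nat_Suc)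
  have t0: "t \<longlonglongrightarrow> 0" unfolding t_def[abs_def] by (rule LIMSEQ_inverse_complex_Suc)
  define \<Phi> where "\<Phi> n s = (f (x + s *\<^sub>C h + t n *\<^sub>C k) - f (x + s *\<^sub>C h)) / t n" for n s
  define \<Phi>' where "\<Phi>' n s = (cdual_apply (grad f (x + s *\<^sub>C h + t n *\<^sub>C k)) h
    - cdual_apply (grad f (x + s *\<^sub>C h)) h) / t n" for n s
  define p where "p s = cdual_apply (grad f (x + s *\<^sub>C h)) k" for s
  have der: "(\<Phi> n has_field_derivative \<Phi>' n s) (at s)" for n s
  proof -
    have "((\<lambda>s. f ((x + t n *\<^sub>C k) + s *\<^sub>C h)) has_field_derivative
        cdual_apply (grad f ((x + t n *\<^sub>C k) + s *\<^sub>C h)) h) (at s)"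
      by (rule grad_line[OF hol])
    then have "((\<lambda>s. f (x + s *\<^sub>C h + t n *\<^sub>C k)) has_field_derivative
        cdual_apply (grad f (x + s *\<^sub>C h + t n *\<^sub>C k)) h) (at s)"
      by (simp add: add_ac)
    from DERIV_cdivide[OF DERIV_diff[OF this grad_line[OF hol, of x h s]], of "t n"]
    show ?thesis by (simp add: \<Phi>_def[abs_def] \<Phi>'_def)
  qed
  \<comment> \<open>The Taylor remainder on the disc of radius 2 in direction \<open>k\<close>,
    divided by \<open>t n\<close>, gives a rate independent of \<open>s\<close>.\<close>
  have est: "norm (\<Phi> n s - p s) \<le> M / 2 * norm (t n)" if s: "norm s \<le> 1" for n s
  proof -
    have sh: "norm (x + s *\<^sub>C h) \<le> norm x + norm h"
      using s mult_right_mono[OF s, of "norm h"] norm_triangle_ineq[of x "s *\<^sub>C h"]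
      by (simp add: norm_scaleC)
    have *: "norm (f (x + s *\<^sub>C h + t n *\<^sub>C k) - f (x + s *\<^sub>C h + 0 *\<^sub>C k)
        - t n * cdual_apply (grad f (x + s *\<^sub>C h + 0 *\<^sub>C k)) k) \<le> 2 * M * (norm (t n) / 2) ^ 2"
    proof (rule entire_linear_remainder[OF grad_line[OF hol]])
      fix \<tau> :: complex assume \<tau>: "norm \<tau> \<le> 2"
      then show "norm (f (x + s *\<^sub>C h + \<tau> *\<^sub>C k)) \<le> M"
        using sh mult_right_mono[OF \<tau>, of "norm k"] norm_triangle_ineq[of "x + s *\<^sub>C h" "\<tau> *\<^sub>C k"]
        by (intro M) (simp add: norm_scaleC)
    qed (use t in auto)
    have "norm (t n * (\<Phi> n s - p s)) \<le> 2 * M * (norm (t n) / 2) ^ 2"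
    proof -
      have "t n * \<Phi> n s = f (x + s *\<^sub>C h + t n *\<^sub>C k) - f (x + s *\<^sub>C h)"
        using t(1)[of n] by (simp add: \<Phi>_def)
      then show ?thesis using * by (simp add: p_def right_diff_distrib)
    qed
    then have "norm (t n) * norm (\<Phi> n s - p s) \<le> norm (t n) * (M / 2 * norm (t n))"
      unfolding norm_mult by (simp add: power2_eq_square mult_ac)
    then show ?thesis using t(1)[of n] by (simp only: mult_le_cancel_left_pos zero_less_norm_iff not_False_eq_True)
  qed
  have ulim: "uniform_limit (cball 0 1) \<Phi> p sequentially"
  proof (rule uniform_limitI)
    fix e :: real assume e: "e > 0"
    have "(\<lambda>n. M / 2 * norm (t n)) \<longlonglongrightarrow> M / 2 * norm (0::complex)"
      by (intro tendsto_intros t0)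
    then have "\<forall>\<^sub>F n in sequentially. M / 2 * norm (t n) < e"
      using e by (intro order_tendstoD) auto
    then show "\<forall>\<^sub>F n in sequentially. \<forall>s\<in>cball 0 1. dist (\<Phi> n s) (p s) < e"
    proof (rule eventually_mono, intro ballI)
      fix n s assume "M / 2 * norm (t n) < e" "s \<in> cball (0::complex) 1"
      then show "dist (\<Phi> n s) (p s) < e" using est[of s n] by (simp add: dist_norm)
    qed
  qed
  have cont: "\<forall>\<^sub>F n in sequentially. continuous_on (cball 0 1) (\<Phi> n) \<and>
      (\<forall>w \<in> ball 0 1. (\<Phi> n has_field_derivative \<Phi>' n w) (at w))"
    using der by (auto intro!: always_eventually continuous_at_imp_continuous_on DERIV_isCont)
  obtain g' where g': "\<And>w. w \<in> ball 0 1 \<Longrightarrow>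
      (p has_field_derivative (g' w)) (at w) \<and> ((\<lambda>n. \<Phi>' n w) \<longlonglongrightarrow> g' w)"
    using has_complex_derivative_uniform_limit[OF cont ulim trivial_limit_sequentially zero_less_one]
    by blast
  show thesis
    using g'[of 0] by (intro that[of "g' 0"]) (auto simp: p_def[abs_def] \<Phi>'_def t_def)
qed

text \<open>\<open>H y h k\<close> is the second directional derivative. It is linear in
  \<open>k\<close>, and symmetry carries linearity over to \<open>h\<close>. Cauchy's estimate
  bounds it, and the one-variable remainder, uniform over \<open>k\<close> in the unit ball,
  upgrades directional to Frechet differentiability.\<close>

lemma has_derivative_of_grad:
  assumes f: "bounded_type f"
  obtains T where "clinear T" "bounded_linear T"
    "\<And>h k. cdual_apply (T h) k = cdual_apply (T k) h" "(grad f has_derivative T) (at x)"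
proof -
  have hol: "holomorphic_fun f" using f by (simp add: bounded_type_def)
  define P where "P y h k c \<longleftrightarrow>
     ((\<lambda>s. cdual_apply (grad f (y + s *\<^sub>C h)) k) has_field_derivative c) (at 0) \<and>
     (\<lambda>n. (cdual_apply (grad f (y + (1 / of_nat (Suc n)) *\<^sub>C k)) h - cdual_apply (grad f y) h)
            / (1 / of_nat (Suc n))) \<longlonglongrightarrow> c" for y h k c
  define H where "H y h k = (SOME c. P y h k c)" for y h k
  have P: "P y h k (H y h k)" for y h k
    unfolding H_def by (rule someI_ex, rule grad_line_derivative[OF f, of y h k]) (auto simp: P_def)
  have H0: "((\<lambda>s. cdual_apply (grad f (y + s *\<^sub>C h)) k) has_field_derivative H y h k) (at 0)"
    for y h k using P[of y h k] by (simp add: P_def)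
  have lim: "(\<lambda>n. (cdual_apply (grad f (y + (1 / of_nat (Suc n)) *\<^sub>C k)) h
        - cdual_apply (grad f y) h) / (1 / of_nat (Suc n))) \<longlonglongrightarrow> H y h k"
    for y h k using P[of y h k] by (simp only: P_def)
  \<comment> \<open>Both sides are the limit of the same sequence, the difference quotients in
    direction \<open>k\<close> of the \<open>h\<close>-derivative.\<close>
  have sym: "H y h k = H y k h" for y h k
    using LIMSEQ_unique[OF lim[where y = y and h = h and k = k]] difference_quotient_sequence[OF H0[of y k h]]
    by (simp del: of_nat_Suc)
  have H: "((\<lambda>s. cdual_apply (grad f (y + s *\<^sub>C h)) k) has_field_derivative H (y + s *\<^sub>C h) h k) (at s)"
    for y h k s
  proof -
    have "(\<lambda>r. cdual_apply (grad f (y + s *\<^sub>C h + r *\<^sub>C h)) k) = (\<lambda>r. cdual_apply (grad f (y + (r + s) *\<^sub>C h)) k)"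
      by (simp add: scaleC_add_left add_ac)
    with H0[of "y + s *\<^sub>C h" h k] show ?thesis
      using DERIV_shift[of "\<lambda>s. cdual_apply (grad f (y + s *\<^sub>C h)) k" _ 0 s] by simp
  qed
  have add_k: "H y h (k + k') = H y h k + H y h k'" for y h k k'
    using DERIV_unique[OF H0[of y h "k + k'"]] DERIV_add[OF H0[of y h k] H0[of y h k']]
    by (simp add: cdual_apply_arg_add)
  have sc_k: "H y h (c *\<^sub>C k) = c * H y h k" for y h k c
    using DERIV_unique[OF H0[of y h "c *\<^sub>C k"]] DERIV_cmult[OF H0[of y h k], of c]
    by (simp add: cdual_apply_arg_scaleC)
  \<comment> \<open>One unit is for the displacement \<open>s *\<^sub>C h\<close>, the other for the
    radius of the Cauchy estimate.\<close>
  obtain M where M: "\<And>y. norm y \<le> norm x + 2 \<Longrightarrow> norm (f y) \<le> M"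
    using f unfolding bounded_type_def by blast
  have M0: "0 \<le> M" using M[of x] norm_ge_zero[of "f x"] by linarith
  have gradM: "norm (grad f (x + s *\<^sub>C h)) \<le> M" if h: "h \<noteq> 0" and s: "norm s \<le> 1 / norm h" for s h
  proof -
    have sh: "norm (s *\<^sub>C h) \<le> 1" using s h by (simp add: norm_scaleC field_simps)
    have "norm (grad f (x + s *\<^sub>C h)) \<le> M / 1"
    proof (rule norm_grad_le[OF hol])
      fix y assume y: "norm (y - (x + s *\<^sub>C h)) \<le> 1"
      have "norm y \<le> norm (y - (x + s *\<^sub>C h)) + norm (x + s *\<^sub>C h)" by (metis norm_triangle_sub add.commute)
      also have "\<dots> \<le> 1 + (norm x + 1)" using y sh norm_triangle_ineq[of x "s *\<^sub>C h"] by linarith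
      finally show "norm (f y) \<le> M" by (intro M) simp
    qed simp
    then show ?thesis by simp
  qed
  have pM: "norm (cdual_apply (grad f (x + s *\<^sub>C h)) k) \<le> M * norm k"
    if "h \<noteq> 0" "norm s \<le> 1 / norm h" for s h k
    using cdual_bound[of "grad f (x + s *\<^sub>C h)" k] mult_right_mono[OF gradM[OF that], of "norm k"] by simp
  have Hb: "norm (H x h k) \<le> M * norm h * norm k" for h k
  proof (cases "h = 0")
    case True
    then show ?thesis using sc_k[of x k 0 h] sym[of x h k] by simp
  next
    case False
    then show ?thesis
      using entire_deriv_bound[OF H[of x h k], of "1 / norm h" "M * norm k"] pM[OF False]
      by (simp add: mult_ac)
  qed
  define T where "T h = cdual_of (H x h)" for h
  have T: "cdual_apply (T h) k = H x h k" for h k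
    unfolding T_def
    by (subst cdual_apply_of)
      (auto intro!: clinearI clinear_bounded[where K = "M * norm h"] simp: add_k sc_k scaleC_complex_def Hb)
  have clin: "clinear T"
    by (rule clinearI)
      (simp_all add: cdual_eq_iff cdual_apply_add cdual_apply_scaleC T sym[of x _ k for k] add_k sc_k)
  have blin: "bounded_linear T"
    by (rule clinear_bounded[OF clin, of M], rule cdual_norm_le) (simp_all add: T Hb M0)
  have "(grad f has_derivative T) (at x)"
  proof (rule has_derivative_quadratic_remainder[OF blin])
    fix h :: 'a assume h: "norm h \<le> 1 / 2"
    show "norm (grad f (x + h) - grad f x - T h) \<le> 2 * M * norm h ^ 2"
    proof (cases "h = 0")
      case True
      then show ?thesis by (simp add: clinear_zero[OF clin])
    next
      case False
      show ?thesis
      proof (rule cdual_norm_le)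
        fix k
        have "norm (cdual_apply (grad f (x + 1 *\<^sub>C h)) k - cdual_apply (grad f (x + 0 *\<^sub>C h)) k
           - 1 * H (x + 0 *\<^sub>C h) h k) \<le> 2 * (M * norm k) * (norm (1::complex) / (1 / norm h)) ^ 2"
          by (rule entire_linear_remainder[OF H])
            (use False h pM[OF False] in \<open>auto simp: field_simps\<close>)
        then show "norm (cdual_apply (grad f (x + h) - grad f x - T h) k) \<le> 2 * M * norm h ^ 2 * norm k"
          by (simp add: cdual_apply_diff T mult_ac)
      qed (simp add: M0)
    qed
  qed simp
  then show thesis using that[OF clin blin] T sym by simp
qed

section \<open>The algebra HV\<close>

lemma cdual_apply_add_abs: "cdual_apply (\<phi> + \<psi>) = (\<lambda>x. cdual_apply \<phi> x + cdual_apply \<psi> x)"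
  and cdual_apply_scaleC_abs: "cdual_apply (c *\<^sub>C \<phi>) = (\<lambda>x. c * cdual_apply \<phi> x)"
  by (simp_all add: fun_eq_iff cdual_apply_add cdual_apply_scaleC)

lemma has_derivative_cdual_add:
  assumes "(f has_derivative cdual_apply \<phi>) (at x)" "(g has_derivative cdual_apply \<psi>) (at x)"
  shows "((\<lambda>x. f x + g x) has_derivative cdual_apply (\<phi> + \<psi>)) (at x)"
  unfolding cdual_apply_add_abs by (intro has_derivative_add assms)

lemma has_derivative_cdual_mult:
  assumes "(f has_derivative cdual_apply \<phi>) (at x)" "(g has_derivative cdual_apply \<psi>) (at x)"
  shows "((\<lambda>x. f x * g x) has_derivative cdual_apply (f x *\<^sub>C \<psi> + g x *\<^sub>C \<phi>)) (at x)"
  using has_derivative_mult[OF assms]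
  by (simp add: cdual_apply_add_abs cdual_apply_scaleC_abs mult.commute[of "g x"])

lemma has_derivative_cdual_const: "((\<lambda>x. c) has_derivative cdual_apply 0) (at x)"
  by (simp add: cdual_apply_zero[abs_def])

lemma has_derivative_cdual_cmult:
  assumes "(f has_derivative cdual_apply \<phi>) (at x)"
  shows "((\<lambda>x. c * f x) has_derivative cdual_apply (c *\<^sub>C \<phi>)) (at x)"
  unfolding cdual_apply_scaleC_abs by (intro has_derivative_mult_right assms)

lemma has_derivative_cdual_apply: "(cdual_apply \<phi> has_derivative cdual_apply \<phi>) (at x)"
  by (intro bounded_linear_imp_has_derivative bounded_linear_cdual_apply)

lemma grad_add:
  "holomorphic_fun f \<Longrightarrow> holomorphic_fun g \<Longrightarrow> grad (\<lambda>x. f x + g x) x = grad f x + grad g x"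
  by (intro grad_eqI has_derivative_cdual_add has_derivative_grad)

lemma grad_mult:
  "holomorphic_fun f \<Longrightarrow> holomorphic_fun g \<Longrightarrow>
    grad (\<lambda>x. f x * g x) x = f x *\<^sub>C grad g x + g x *\<^sub>C grad f x"
  by (intro grad_eqI has_derivative_cdual_mult has_derivative_grad)

lemma grad_cmult: "holomorphic_fun f \<Longrightarrow> grad (\<lambda>x. c * f x) x = c *\<^sub>C grad f x"
  by (intro grad_eqI has_derivative_cdual_cmult has_derivative_grad)

section \<open>Membership in HV and closure under the algebra operations\<close>

lemma HV_iff:
  "f \<in> HV \<longleftrightarrow> holomorphic_fun f \<and> (\<forall>n\<ge>1. \<exists>C. \<forall>x. norm (f x) \<le> C * exp (norm x / real n))"
proof -
  have "exp (- norm x / real n) * norm (f x) \<le> C \<longleftrightarrow> norm (f x) \<le> C * exp (norm x / real n)"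
    for n C and x :: 'a
    by (simp add: exp_minus field_simps)
  then show ?thesis by (simp add: HV_def bdd_above_def)
qed

lemma HV_holomorphic: "f \<in> HV \<Longrightarrow> holomorphic_fun f"
  by (simp add: HV_iff)

lemma HV_bound:
  assumes "f \<in> HV" "1 \<le> n"
  shows "norm (f x) \<le> HV_seminorm n f * exp (norm x / real n)"
proof -
  have "exp (- norm x / real n) * norm (f x) \<le> HV_seminorm n f"
    unfolding HV_seminorm_def using assms by (intro cSUP_upper) (auto simp: HV_def)
  then show ?thesis by (simp add: exp_minus field_simps)
qed

lemma HV_seminorm_le:
  assumes "\<And>x. norm (f x) \<le> C * exp (norm x / real n)"
  shows "HV_seminorm n f \<le> C"
  unfolding HV_seminorm_def
  by (rule cSUP_least) (use assms in \<open>auto simp: exp_minus field_simps\<close>)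

lemma HV_seminorm_nonneg:
  assumes "f \<in> HV" "1 \<le> n" shows "0 \<le> HV_seminorm n f"
  using order_trans[OF norm_ge_zero HV_bound[OF assms, of 0]] by simp

lemma HV_add: assumes "f \<in> HV" "g \<in> HV" shows "(\<lambda>x. f x + g x) \<in> HV"
proof -
  have "holomorphic_fun (\<lambda>x. f x + g x)"
    by (rule holomorphic_funI, rule has_derivative_cdual_add[OF has_derivative_grad has_derivative_grad])
      (simp_all add: HV_holomorphic assms)
  moreover have "norm (f x + g x) \<le> (HV_seminorm n f + HV_seminorm n g) * exp (norm x / real n)"
    if "1 \<le> n" for n x
    using norm_triangle_ineq[of "f x" "g x"] HV_bound[OF assms(1) that, of x] HV_bound[OF assms(2) that, of x]
    by (simp add: distrib_right)
  ultimately show ?thesis by (auto simp: HV_iff)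
qed

lemma HV_cmult: assumes "f \<in> HV" shows "(\<lambda>x. c * f x) \<in> HV"
proof -
  have "holomorphic_fun (\<lambda>x. c * f x)"
    by (rule holomorphic_funI, rule has_derivative_cdual_cmult[OF has_derivative_grad])
      (simp_all add: HV_holomorphic assms)
  moreover have "norm (c * f x) \<le> (norm c * HV_seminorm n f) * exp (norm x / real n)"
    if "1 \<le> n" for n x
    using mult_left_mono[OF HV_bound[OF assms that, of x], of "norm c"] by (simp add: norm_mult mult_ac)
  ultimately show ?thesis by (auto simp: HV_iff)
qed

lemma HV_mult: assumes "f \<in> HV" "g \<in> HV" shows "(\<lambda>x. f x * g x) \<in> HV"
proof -
  have "holomorphic_fun (\<lambda>x. f x * g x)"
    by (rule holomorphic_funI, rule has_derivative_cdual_mult[OF has_derivative_grad has_derivative_grad])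
      (simp_all add: HV_holomorphic assms)
  moreover have "norm (f x * g x) \<le> (HV_seminorm (2 * n) f * HV_seminorm (2 * n) g) * exp (norm x / real n)"
    if n: "1 \<le> n" for n x
  proof -
    have n2: "1 \<le> 2 * n" using n by simp
    \<comment> \<open>Two exponential weights of index \<open>2 * n\<close> multiply to one of index
      \<open>n\<close>.\<close>
    have "norm (f x * g x) \<le> (HV_seminorm (2 * n) f * exp (norm x / real (2 * n)))
        * (HV_seminorm (2 * n) g * exp (norm x / real (2 * n)))"
      unfolding norm_mult
      by (intro mult_mono HV_bound assms n2 mult_nonneg_nonneg HV_seminorm_nonneg) auto
    also have "\<dots> = (HV_seminorm (2 * n) f * HV_seminorm (2 * n) g)
        * (exp (norm x / real (2 * n)) * exp (norm x / real (2 * n)))" by (simp only: mult_ac)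
    also have "exp (norm x / real (2 * n)) * exp (norm x / real (2 * n)) = exp (norm x / real n)"
      by (simp flip: exp_add)
    finally show ?thesis .
  qed
  ultimately show ?thesis by (auto simp: HV_iff)
qed

lemma HV_const: "(\<lambda>x. c) \<in> HV"
proof -
  have "norm c \<le> norm c * exp (norm x / real n)" for n and x :: 'a
    using mult_left_mono[of 1 "exp (norm x / real n)" "norm c"] by simp
  moreover have "holomorphic_fun (\<lambda>x::'a. c)"
    by (rule holomorphic_funI, rule has_derivative_cdual_const)
  ultimately show ?thesis by (auto simp: HV_iff)
qed

lemma HV_diff: assumes "f \<in> HV" "g \<in> HV" shows "(\<lambda>x. f x - g x) \<in> HV"
  using HV_add[OF assms(1) HV_cmult[OF assms(2), of "-1"]] by simp

lemma HV_power: assumes "f \<in> HV" shows "(\<lambda>x. f x ^ k) \<in> HV"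
  by (induction k) (simp_all add: HV_const HV_mult assms)

text \<open>This is \<open>u \<le> exp u\<close> for \<open>u = t / (k m)\<close>, raised to the
  power \<open>k\<close>. The constant is a \<open>k\<close>-th power with root linear in
  \<open>k\<close>, which later produces linear growth.\<close>

lemma power_le_exp:
  assumes "0 \<le> t" "1 \<le> m" "1 \<le> k"
  shows "t ^ k \<le> (real k * real m) ^ k * exp (t / real m)"
proof -
  define u where "u = t / (real k * real m)"
  have "0 \<le> u" using assms by (simp add: u_def)
  then have "u ^ k \<le> exp u ^ k"
    using exp_ge_add_one_self[of u] by (intro power_mono) linarith
  also have "exp u ^ k = exp (t / real m)"
    using assms by (simp add: u_def field_simps flip: exp_of_nat_mult)
  finally show ?thesis using assms by (simp add: u_def power_divide field_simps)
qed

lemma norm_cdual_power_le: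
  assumes "1 \<le> m" "1 \<le> k"
  shows "norm (cdual_apply \<gamma> x ^ k) \<le> (norm \<gamma> * real k * real m) ^ k * exp (norm x / real m)"
proof -
  have "norm (cdual_apply \<gamma> x ^ k) \<le> (norm \<gamma> * norm x) ^ k"
    unfolding norm_power by (intro power_mono cdual_bound) simp
  also have "\<dots> \<le> norm \<gamma> ^ k * ((real k * real m) ^ k * exp (norm x / real m))"
    unfolding power_mult_distrib[of "norm \<gamma>" "norm x"] by (intro mult_left_mono power_le_exp assms) auto
  finally show ?thesis by (simp add: power_mult_distrib mult_ac)
qed

lemma HV_cdual: "cdual_apply \<gamma> \<in> HV"
  unfolding HV_iff using norm_cdual_power_le[of _ 1 \<gamma>]
  by (auto intro!: holomorphic_funI[where \<phi> = "\<lambda>_. \<gamma>"] has_derivative_cdual_apply)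

section \<open>Seminorm inequalities and the topology they generate\<close>

lemma HV_seminorm_triangle:
  assumes "f \<in> HV" "g \<in> HV" "1 \<le> n"
  shows "HV_seminorm n (\<lambda>x. f x + g x) \<le> HV_seminorm n f + HV_seminorm n g"
proof (rule HV_seminorm_le)
  fix x
  show "norm (f x + g x) \<le> (HV_seminorm n f + HV_seminorm n g) * exp (norm x / real n)"
    using norm_triangle_ineq[of "f x" "g x"] HV_bound[OF assms(1,3), of x] HV_bound[OF assms(2,3), of x]
    by (simp add: distrib_right)
qed

lemma HV_seminorm_cmult_le:
  assumes "f \<in> HV" "1 \<le> n"
  shows "HV_seminorm n (\<lambda>x. c * f x) \<le> norm c * HV_seminorm n f"
proof (rule HV_seminorm_le)
  fix x
  show "norm (c * f x) \<le> (norm c * HV_seminorm n f) * exp (norm x / real n)"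
    using mult_left_mono[OF HV_bound[OF assms, of x], of "norm c"] by (simp add: norm_mult mult_ac)
qed

lemma HV_seminorm_zero: "HV_seminorm n (\<lambda>x. 0) = 0"
  by (simp add: HV_seminorm_def)

lemma HV_seminorm_mono:
  fixes f :: "'a::complex_normed_vector \<Rightarrow> complex"
  assumes "f \<in> HV" "1 \<le> n" "n \<le> m"
  shows "HV_seminorm n f \<le> HV_seminorm m f"
proof (rule HV_seminorm_le)
  fix x :: 'a
  have m: "1 \<le> m" using assms by simp
  have "norm x / real m \<le> norm x / real n" using assms by (intro divide_left_mono) auto
  then show "norm (f x) \<le> HV_seminorm m f * exp (norm x / real n)"
    using HV_bound[OF assms(1) m, of x] HV_seminorm_nonneg[OF assms(1) m]
    by (meson exp_le_cancel_iff mult_left_mono order_trans)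
qed

text \<open>The generating balls form only a subbase. They give neighbourhood bases because the
  seminorms increase with the index: two balls at \<open>f\<close> contain the ball at
  \<open>f\<close> with the larger index and the smaller radius.\<close>

lemma openin_HV_iff:
  "openin HV_topology U \<longleftrightarrow> U \<subseteq> HV \<and>
    (\<forall>f\<in>U. \<exists>n\<ge>1. \<exists>e>0. {g \<in> HV. HV_seminorm n (\<lambda>x. g x - f x) < e} \<subseteq> U)"
    (is "_ \<longleftrightarrow> ?R U")
proof
  let ?S = "{{g \<in> HV. HV_seminorm n (\<lambda>x. g x - f x) < e} | f n e. f \<in> HV \<and> 1 \<le> n \<and> 0 < e}
    :: ('a \<Rightarrow> complex) set set"
  assume "openin HV_topology U"
  then have "generate_topology_on ?S U"
    by (simp add: HV_topology_def openin_topology_generated_by_iff)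
  then show "?R U"
  proof induction
    case Empty
    then show ?case by simp
  next
    case (Int A B)
    show ?case
    proof (intro conjI ballI)
      fix f assume f: "f \<in> A \<inter> B"
      have "f \<in> A" "f \<in> B" using f by auto
      obtain n e where n: "n \<ge> 1" "e > 0" "{g \<in> HV. HV_seminorm n (\<lambda>x. g x - f x) < e} \<subseteq> A"
        using Int.IH(1) \<open>f \<in> A\<close> by blast
      obtain m d where m: "m \<ge> 1" "d > 0" "{g \<in> HV. HV_seminorm m (\<lambda>x. g x - f x) < d} \<subseteq> B"
        using Int.IH(2) \<open>f \<in> B\<close> by blast
      have fHV: "f \<in> HV" using f Int by auto
      have "{g \<in> HV. HV_seminorm (max n m) (\<lambda>x. g x - f x) < min e d} \<subseteq> A \<inter> B"
      proof
        fix g assume g: "g \<in> {g \<in> HV. HV_seminorm (max n m) (\<lambda>x. g x - f x) < min e d}"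
        then have "(\<lambda>x. g x - f x) \<in> HV" using HV_diff fHV by auto
        from HV_seminorm_mono[OF this n(1), of "max n m"] HV_seminorm_mono[OF this m(1), of "max n m"]
        show "g \<in> A \<inter> B" using g n m by auto
      qed
      then show "\<exists>n\<ge>1. \<exists>e>0. {g \<in> HV. HV_seminorm n (\<lambda>x. g x - f x) < e} \<subseteq> A \<inter> B"
        using n m by (intro exI[of _ "max n m"] conjI exI[of _ "min e d"]) auto
    qed (use Int in auto)
  next
    case (UN K)
    show ?case
    proof (intro conjI ballI)
      fix f assume "f \<in> \<Union>K"
      then obtain A where A: "A \<in> K" "f \<in> A" by blast
      then obtain n e where n: "n \<ge> 1" "e > 0" "{g \<in> HV. HV_seminorm n (\<lambda>x. g x - f x) < e} \<subseteq> A"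
        using UN.IH[of A] by blast
      then show "\<exists>n\<ge>1. \<exists>e>0. {g \<in> HV. HV_seminorm n (\<lambda>x. g x - f x) < e} \<subseteq> \<Union>K"
        using A(1) by (meson Union_upper order_trans)
    qed (use UN in blast)
  next
    case (Basis s)
    then obtain f n e where s: "s = {g \<in> HV. HV_seminorm n (\<lambda>x. g x - f x) < e}"
      and f: "f \<in> HV" "1 \<le> n" "0 < e" by auto
    show ?case
    proof (intro conjI ballI)
      fix h assume h: "h \<in> s"
      define d where "d = e - HV_seminorm n (\<lambda>x. h x - f x)"
      have "{g \<in> HV. HV_seminorm n (\<lambda>x. g x - h x) < d} \<subseteq> s"
      proof
        fix g assume g: "g \<in> {g \<in> HV. HV_seminorm n (\<lambda>x. g x - h x) < d}"
        have "HV_seminorm n (\<lambda>x. (g x - h x) + (h x - f x))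
          \<le> HV_seminorm n (\<lambda>x. g x - h x) + HV_seminorm n (\<lambda>x. h x - f x)"
          using g h s f by (intro HV_seminorm_triangle HV_diff) auto
        then show "g \<in> s" using g by (simp add: s d_def)
      qed
      moreover have "d > 0" using h by (simp add: s d_def)
      ultimately show "\<exists>n\<ge>1. \<exists>e>0. {g \<in> HV. HV_seminorm n (\<lambda>x. g x - h x) < e} \<subseteq> s"
        using f by blast
    qed (use s in auto)
  qed
next
  assume R: "?R U"
  then have UHV: "U \<subseteq> HV"
    and ball: "\<And>f. f \<in> U \<Longrightarrow> \<exists>n\<ge>1. \<exists>e>0. {g \<in> HV. HV_seminorm n (\<lambda>x. g x - f x) < e} \<subseteq> U"
    by blast+
  show "openin HV_topology U"
  proof (subst openin_subopen, intro ballI)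
    fix f assume f: "f \<in> U"
    obtain n e where n: "n \<ge> 1" "e > 0" "{g \<in> HV. HV_seminorm n (\<lambda>x. g x - f x) < e} \<subseteq> U"
      using ball[OF f] by blast
    have "f \<in> HV" using UHV f by auto
    have "openin HV_topology {g \<in> HV. HV_seminorm n (\<lambda>x. g x - f x) < e}"
      unfolding HV_topology_def using n \<open>f \<in> HV\<close>
      by (intro topology_generated_by_Basis) blast
    moreover have "f \<in> {g \<in> HV. HV_seminorm n (\<lambda>x. g x - f x) < e}"
      using n \<open>f \<in> HV\<close> by (simp add: HV_seminorm_zero)
    ultimately show "\<exists>T. openin HV_topology T \<and> f \<in> T \<and> T \<subseteq> U" using n(3) by blast
  qed
qed

lemma continuous_map_HV_I:
  fixes \<Phi> :: "('a::complex_normed_vector \<Rightarrow> complex) \<Rightarrow> ('b::complex_normed_vector \<Rightarrow> complex)"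
  assumes HV: "\<And>f. f \<in> HV \<Longrightarrow> \<Phi> f \<in> HV"
    and diff: "\<And>f g. f \<in> HV \<Longrightarrow> g \<in> HV \<Longrightarrow> \<Phi> (\<lambda>x. f x - g x) = (\<lambda>y. \<Phi> f y - \<Phi> g y)"
    and bd: "\<And>n. 1 \<le> n \<Longrightarrow> \<exists>m\<ge>1. \<forall>f\<in>HV. HV_seminorm n (\<Phi> f) \<le> HV_seminorm m f"
  shows "continuous_map HV_topology HV_topology \<Phi>"
  unfolding continuous_map
proof (intro conjI allI impI)
  show "\<Phi> ` topspace HV_topology \<subseteq> topspace HV_topology" using HV by auto
  fix U :: "('b \<Rightarrow> complex) set" assume U: "openin HV_topology U"
  show "openin HV_topology {f \<in> topspace HV_topology. \<Phi> f \<in> U}"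
    unfolding openin_HV_iff
  proof (intro conjI ballI)
    fix f assume f: "f \<in> {f \<in> topspace HV_topology. \<Phi> f \<in> U}"
    then obtain n e where n: "n \<ge> 1" "e > 0" "{g \<in> HV. HV_seminorm n (\<lambda>x. g x - \<Phi> f x) < e} \<subseteq> U"
      using U unfolding openin_HV_iff by blast
    obtain m where m: "m \<ge> 1" "\<And>f. f \<in> HV \<Longrightarrow> HV_seminorm n (\<Phi> f) \<le> HV_seminorm m f"
      using bd n by blast
    have "{g \<in> HV. HV_seminorm m (\<lambda>x. g x - f x) < e} \<subseteq> {f \<in> topspace HV_topology. \<Phi> f \<in> U}"
    proof
      fix g assume g: "g \<in> {g \<in> HV. HV_seminorm m (\<lambda>x. g x - f x) < e}"
      then have "HV_seminorm n (\<lambda>x. \<Phi> g x - \<Phi> f x) < e"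
        using m(2)[of "\<lambda>x. g x - f x"] f by (simp add: diff HV_diff)
      then show "g \<in> {f \<in> topspace HV_topology. \<Phi> f \<in> U}" using g n(3) HV by auto
    qed
    then show "\<exists>n\<ge>1. \<exists>e>0. {g \<in> HV. HV_seminorm n (\<lambda>x. g x - f x) < e} \<subseteq> {f \<in> topspace HV_topology. \<Phi> f \<in> U}"
      using m n by blast
  qed simp
qed

text \<open>The preimage of the unit ball of the \<open>n\<close>-th seminorm contains a ball of
  radius \<open>e\<close> for some \<open>m\<close>-th one; scaling \<open>f\<close> to seminorm
  \<open>e / 2\<close> yields the constant \<open>2 / e\<close>.\<close>

lemma continuous_map_HV_D:
  fixes \<Phi> :: "('a::complex_normed_vector \<Rightarrow> complex) \<Rightarrow> ('b::complex_normed_vector \<Rightarrow> complex)"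
  assumes cont: "continuous_map HV_topology HV_topology \<Phi>"
    and scale: "\<And>c f. f \<in> HV \<Longrightarrow> \<Phi> (\<lambda>x. c * f x) = (\<lambda>y. c * \<Phi> f y)" and n: "1 \<le> n"
  obtains m C where "m \<ge> 1" "\<And>f. f \<in> HV \<Longrightarrow> HV_seminorm n (\<Phi> f) \<le> C * HV_seminorm m f"
proof -
  have z: "\<Phi> (\<lambda>x. 0) = (\<lambda>y. 0)" using scale[OF HV_const, of 0] by simp
  have HV: "\<Phi> f \<in> HV" if "f \<in> HV" for f
    using cont that unfolding continuous_map by auto
  define U where "U = {f \<in> HV. HV_seminorm n (\<Phi> f) < 1}"
  have "openin HV_topology {g \<in> HV. HV_seminorm n (\<lambda>x. g x - 0) < 1}"
    unfolding HV_topology_def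
    by (rule topology_generated_by_Basis) (use HV_const[of 0] n in force)
  then have "openin HV_topology {f \<in> topspace HV_topology. \<Phi> f \<in> {g \<in> HV. HV_seminorm n (\<lambda>x. g x - 0) < 1}}"
    using cont unfolding continuous_map by blast
  moreover have "{f \<in> topspace HV_topology. \<Phi> f \<in> {g \<in> HV. HV_seminorm n (\<lambda>x. g x - 0) < 1}} = U"
    using HV by (auto simp: U_def)
  ultimately have U: "openin HV_topology U" by simp
  have U0: "(\<lambda>x. 0) \<in> U" by (simp add: U_def HV_const z HV_seminorm_zero)
  obtain m e where m: "m \<ge> 1" "e > 0" "{g \<in> HV. HV_seminorm m (\<lambda>x. g x - 0) < e} \<subseteq> U"
    using openin_HV_iff[THEN iffD1, OF U, THEN conjunct2, THEN bspec, OF U0] by blast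
  show thesis
  proof (rule that[OF m(1), of "2 / e"])
    fix f :: "'a \<Rightarrow> complex" assume f: "f \<in> HV"
    define p where "p = HV_seminorm m f"
    have p0: "p \<ge> 0" using HV_seminorm_nonneg[OF f m(1)] by (simp add: p_def)
    show "HV_seminorm n (\<Phi> f) \<le> 2 / e * HV_seminorm m f"
    proof (cases "p = 0")
      case True
      \<comment> \<open>The weighted supremum vanishes only at the zero function, so the case that
        cannot be scaled is trivial.\<close>
      have "f = (\<lambda>x. 0)"
      proof
        fix x show "f x = 0" using HV_bound[OF f m(1), of x] True by (simp add: p_def)
      qed
      then show ?thesis by (simp add: z HV_seminorm_zero)
    next
      case False
      then have p: "p > 0" using p0 by simp
      define c where "c = e / (2 * p)"
      have c: "c > 0" using p m by (simp add: c_def)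
      have "HV_seminorm m (\<lambda>x. of_real c * f x) \<le> norm (of_real c :: complex) * HV_seminorm m f"
        by (rule HV_seminorm_cmult_le[OF f m(1)])
      also have "\<dots> = c * p" using c by (simp add: p_def)
      also have "\<dots> < e" using p m(2) by (simp add: c_def)
      finally have "(\<lambda>x. of_real c * f x) \<in> U"
        using m(3) f HV_cmult by auto
      then have lt: "HV_seminorm n (\<lambda>y. of_real c * \<Phi> f y) < 1" by (simp add: U_def scale[OF f])
      have "HV_seminorm n (\<Phi> f) \<le> 1 / c"
      proof (rule HV_seminorm_le)
        fix y
        have "norm (of_real c * \<Phi> f y) \<le> HV_seminorm n (\<lambda>y. of_real c * \<Phi> f y) * exp (norm y / real n)"
          by (rule HV_bound[OF HV_cmult[OF HV[OF f]] n])
        also have "\<dots> \<le> 1 * exp (norm y / real n)" using lt by (intro mult_right_mono) auto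
        finally show "norm (\<Phi> f y) \<le> 1 / c * exp (norm y / real n)"
          using c by (simp add: norm_mult field_simps)
      qed
      then show ?thesis using p m(2) by (simp add: c_def p_def field_simps)
    qed
  qed
qed

section \<open>From algebra isomorphisms to dual isomorphisms\<close>

lemma HV_iso_continuous: "HV_iso \<Phi> \<Longrightarrow> continuous_map HV_topology HV_topology \<Phi>"
  by (simp add: HV_iso_def homeomorphic_imp_continuous_map)

lemma HV_iso_HV: "HV_iso \<Phi> \<Longrightarrow> f \<in> HV \<Longrightarrow> \<Phi> f \<in> HV"
  by (auto simp: HV_iso_def bij_betw_def)

lemma HV_iso_add:
  "HV_iso \<Phi> \<Longrightarrow> f \<in> HV \<Longrightarrow> g \<in> HV \<Longrightarrow> \<Phi> (\<lambda>x. f x + g x) = (\<lambda>y. \<Phi> f y + \<Phi> g y)"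
  and HV_iso_cmult: "HV_iso \<Phi> \<Longrightarrow> f \<in> HV \<Longrightarrow> \<Phi> (\<lambda>x. c * f x) = (\<lambda>y. c * \<Phi> f y)"
  and HV_iso_mult:
  "HV_iso \<Phi> \<Longrightarrow> f \<in> HV \<Longrightarrow> g \<in> HV \<Longrightarrow> \<Phi> (\<lambda>x. f x * g x) = (\<lambda>y. \<Phi> f y * \<Phi> g y)"
  by (simp_all add: HV_iso_def)

lemma HV_iso_power:
  assumes "HV_iso \<Phi>" "f \<in> HV"
  shows "\<Phi> (\<lambda>x. f x ^ Suc k) = (\<lambda>y. \<Phi> f y ^ Suc k)"
proof (induction k)
  case (Suc k)
  have "\<Phi> (\<lambda>x. f x * f x ^ Suc k) = (\<lambda>y. \<Phi> f y * \<Phi> (\<lambda>x. f x ^ Suc k) y)"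
    by (rule HV_iso_mult[OF assms HV_power[OF assms(2)]])
  then show ?case using Suc by simp
qed simp

text \<open>The image of 1 is neutral for multiplication; testing this on a preimage
  \<open>g\<close> of 1 forces it to be 1.\<close>

lemma HV_iso_const:
  assumes iso: "HV_iso \<Phi>"
  shows "\<Phi> (\<lambda>x. c) = (\<lambda>y. c)"
proof -
  have "(\<lambda>y. 1) \<in> \<Phi> ` HV"
    using iso HV_const[of 1] by (simp add: HV_iso_def bij_betw_def)
  then obtain g where g: "(\<lambda>y. 1) = \<Phi> g" "g \<in> HV" by (rule imageE)
  have "\<Phi> (\<lambda>x. 1 * g x) = (\<lambda>y. \<Phi> (\<lambda>x. 1) y * \<Phi> g y)"
    by (rule HV_iso_mult[OF iso HV_const g(2)])
  then have "\<Phi> (\<lambda>x. 1) = (\<lambda>y. 1)" by (simp flip: g(1))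
  then show ?thesis using HV_iso_cmult[OF iso HV_const, of c 1] by simp
qed

lemma HV_iso_inverse:
  assumes iso: "HV_iso (\<Phi> :: ('a::complex_normed_vector \<Rightarrow> complex) \<Rightarrow> ('b::complex_normed_vector \<Rightarrow> complex))"
  shows "HV_iso (inv_into HV \<Phi>)"
proof -
  let ?I = "inv_into HV \<Phi>"
  have bij: "bij_betw \<Phi> HV HV" using iso by (simp add: HV_iso_def)
  have I: "?I g \<in> HV" "\<Phi> (?I g) = g" if "g \<in> HV" for g
    using that bij by (metis bij_betw_def inv_into_into, metis bij_betw_inv_into_right)
  have eqI: "?I g = f" if "f \<in> HV" "\<Phi> f = g" for f g
    using bij that by (metis bij_betw_inv_into_left)
  obtain \<Psi> where \<Psi>: "homeomorphic_maps HV_topology HV_topology \<Phi> \<Psi>"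
    using iso by (auto simp: HV_iso_def homeomorphic_map_maps)
  then have "homeomorphic_map HV_topology HV_topology \<Psi>"
    by (simp add: homeomorphic_maps_map)
  \<comment> \<open>The topological inverse is determined only on HV; it agrees there with
    \<open>inv_into\<close>, which suffices to transfer the homeomorphism.\<close>
  moreover have "\<Psi> g = ?I g" if "g \<in> HV" for g
  proof -
    have "\<Psi> g \<in> HV" "\<Phi> (\<Psi> g) = g"
      using \<Psi> that by (auto simp: homeomorphic_maps_def continuous_map_def)
    then show ?thesis using eqI by simp
  qed
  ultimately have "homeomorphic_map HV_topology HV_topology ?I"
    using homeomorphic_map_eq[of HV_topology HV_topology \<Psi> ?I] by simp
  moreover have "bij_betw ?I HV HV" by (rule bij_betw_inv_into[OF bij])
  moreover have "?I (\<lambda>x. f x + g x) = (\<lambda>y. ?I f y + ?I g y)" if "f \<in> HV" "g \<in> HV" for f g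
    by (rule eqI) (simp_all add: HV_add HV_iso_add[OF iso] I that)
  moreover have "?I (\<lambda>x. f x * g x) = (\<lambda>y. ?I f y * ?I g y)" if "f \<in> HV" "g \<in> HV" for f g
    by (rule eqI) (simp_all add: HV_mult HV_iso_mult[OF iso] I that)
  moreover have "?I (\<lambda>x. c * f x) = (\<lambda>y. c * ?I f y)" if "f \<in> HV" for c f
    by (rule eqI) (simp_all add: HV_cmult HV_iso_cmult[OF iso] I that)
  ultimately show ?thesis by (simp add: HV_iso_def)
qed

text \<open>Applying the continuity estimate to \<open>\<gamma>\<^sup>k\<close> with \<open>k\<close> of the size of \<open>norm y\<close> and taking \<open>k\<close>-th
  roots turns the exponential weights into linear growth.\<close>

lemma HV_iso_cdual_growth:
  assumes iso: "HV_iso (\<Phi> :: ('a::complex_normed_vector \<Rightarrow> complex) \<Rightarrow> ('b::complex_normed_vector \<Rightarrow> complex))"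
  obtains K where "K \<ge> 0" "\<And>\<gamma> y. norm (\<Phi> (cdual_apply \<gamma>) y) \<le> K * norm \<gamma> * (norm y + 2)"
proof -
  obtain m C where m: "m \<ge> 1"
    and C: "\<And>f. f \<in> HV \<Longrightarrow> HV_seminorm 1 (\<Phi> f) \<le> C * HV_seminorm m f"
    using continuous_map_HV_D[OF HV_iso_continuous[OF iso] HV_iso_cmult[OF iso], of 1] by auto
  define C1 where "C1 = max 1 C"
  have C1: "C1 \<ge> 1" "C \<le> C1" by (auto simp: C1_def)
  show thesis
  proof (rule that[of "C1 * exp 1 * real m"])
    show "0 \<le> C1 * exp 1 * real m" using C1 by simp
    fix \<gamma> :: "'a cdual" and y :: 'b
    \<comment> \<open>Being at least \<open>norm y\<close>, \<open>k\<close> gives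
      \<open>exp (norm y) \<le> exp 1 ^ k\<close>; being at most \<open>norm y + 2\<close>, it makes
      the final bound linear. \<open>Suc\<close> keeps it positive.\<close>
    define k where "k = Suc (nat \<lceil>norm y\<rceil>)"
    have k: "1 \<le> k" "norm y \<le> real k" "real k \<le> norm y + 2"
      by (simp add: k_def) (simp add: k_def; linarith)+
    define h where "h = \<Phi> (cdual_apply \<gamma>)"
    define P where "P = (norm \<gamma> * real k * real m) ^ k"
    have P0: "P \<ge> 0" by (simp add: P_def)
    have HVk: "(\<lambda>x. cdual_apply \<gamma> x ^ k) \<in> HV" by (intro HV_power HV_cdual)
    have semi: "HV_seminorm m (\<lambda>x. cdual_apply \<gamma> x ^ k) \<le> P"
      unfolding P_def by (rule HV_seminorm_le, rule norm_cdual_power_le[OF m k(1)])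
    have "norm (h y) ^ k = norm (\<Phi> (\<lambda>x. cdual_apply \<gamma> x ^ k) y)"
      using HV_iso_power[OF iso HV_cdual] by (simp add: h_def k_def norm_power norm_mult)
    also have "\<dots> \<le> HV_seminorm 1 (\<Phi> (\<lambda>x. cdual_apply \<gamma> x ^ k)) * exp (norm y / real 1)"
      by (rule HV_bound[OF HV_iso_HV[OF iso HVk]]) simp
    also have "\<dots> \<le> (C1 * P) * exp 1 ^ k"
    proof (rule mult_mono)
      have "HV_seminorm 1 (\<Phi> (\<lambda>x. cdual_apply \<gamma> x ^ k)) \<le> C * HV_seminorm m (\<lambda>x. cdual_apply \<gamma> x ^ k)"
        by (rule C[OF HVk])
      also have "\<dots> \<le> C1 * P"
        using C1 semi HV_seminorm_nonneg[OF HVk m] P0 by (intro mult_mono) auto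
      finally show "HV_seminorm 1 (\<Phi> (\<lambda>x. cdual_apply \<gamma> x ^ k)) \<le> C1 * P" .
      show "exp (norm y / real 1) \<le> exp 1 ^ k" using k(2) by (simp flip: exp_of_nat_mult)
    qed (use C1 P0 in auto)
    \<comment> \<open>Since \<open>C1 \<ge> 1\<close>, it may be replaced by \<open>C1 ^ k\<close>,
      which makes the whole bound a \<open>k\<close>-th power.\<close>
    also have "\<dots> \<le> (C1 ^ k * P) * exp 1 ^ k"
      using C1 k(1) P0 by (intro mult_right_mono self_le_power) auto
    also have "\<dots> = (C1 * exp 1 * real m * norm \<gamma> * real k) ^ k"
      by (simp add: P_def power_mult_distrib mult_ac)
    finally have "norm (h y) \<le> C1 * exp 1 * real m * norm \<gamma> * real k"
      by (subst (asm) power_mono_iff) (use C1 k(1) in auto)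
    also have "\<dots> \<le> C1 * exp 1 * real m * norm \<gamma> * (norm y + 2)"
      using k(3) C1 by (intro mult_left_mono) auto
    finally show "norm (\<Phi> (cdual_apply \<gamma>) y) \<le> C1 * exp 1 * real m * norm \<gamma> * (norm y + 2)"
      by (simp add: h_def)
  qed
qed

text \<open>On each complex line through 0 the image is entire of linear growth, hence affine, with
  slope given by the gradient at 0. \<open>S\<close> inherits linearity from \<open>\<Phi>\<close>;
  it is bounded by Cauchy's estimate on the unit ball, where
  \<open>norm y + 2 \<le> 3\<close>.\<close>

lemma HV_iso_cdual_affine:
  assumes iso: "HV_iso (\<Phi> :: ('a::complex_normed_vector \<Rightarrow> complex) \<Rightarrow> ('b::complex_normed_vector \<Rightarrow> complex))"
  obtains S c where "clinear S" "bounded_linear S"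
    "\<And>\<gamma>. \<Phi> (cdual_apply \<gamma>) = (\<lambda>y. c \<gamma> + cdual_apply (S \<gamma>) y)"
proof -
  obtain K where K: "K \<ge> 0" "\<And>\<gamma> y. norm (\<Phi> (cdual_apply \<gamma>) y) \<le> K * norm \<gamma> * (norm y + 2)"
    using HV_iso_cdual_growth[OF iso] by blast
  define S where "S \<gamma> = grad (\<Phi> (cdual_apply \<gamma>)) 0" for \<gamma>
  have hol: "holomorphic_fun (\<Phi> (cdual_apply \<gamma>))" for \<gamma>
    by (intro HV_holomorphic HV_iso_HV[OF iso] HV_cdual)
  have line: "((\<lambda>s. \<Phi> (cdual_apply \<gamma>) (s *\<^sub>C y)) has_field_derivative
      cdual_apply (grad (\<Phi> (cdual_apply \<gamma>)) (s *\<^sub>C y)) y) (at s)" for \<gamma> y s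
    using grad_line[OF hol, of \<gamma> 0 y s] by simp
  have aff: "\<Phi> (cdual_apply \<gamma>) y = \<Phi> (cdual_apply \<gamma>) 0 + cdual_apply (S \<gamma>) y" for \<gamma> y
  proof -
    have "norm (\<Phi> (cdual_apply \<gamma>) (s *\<^sub>C y)) \<le> K * norm \<gamma> * 2 + K * norm \<gamma> * norm y * norm s" for s
      using K(2)[of \<gamma> "s *\<^sub>C y"] by (simp add: norm_scaleC algebra_simps)
    from entire_linear_growth_affine[OF line this, of 1] show ?thesis by (simp add: S_def)
  qed
  have S_le: "norm (S \<gamma>) \<le> 3 * K * norm \<gamma>" for \<gamma>
  proof (rule cdual_norm_le)
    fix y :: 'b
    show "norm (cdual_apply (S \<gamma>) y) \<le> 3 * K * norm \<gamma> * norm y"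
    proof (cases "y = 0")
      case False
      have "norm (cdual_apply (grad (\<Phi> (cdual_apply \<gamma>)) (0 *\<^sub>C y)) y) \<le> (K * norm \<gamma> * 3) / (1 / norm y)"
      proof (rule entire_deriv_bound[OF line])
        fix s :: complex assume s: "norm s \<le> 1 / norm y"
        then have "norm (s *\<^sub>C y) \<le> 1" using False by (simp add: norm_scaleC field_simps)
        then have "K * norm \<gamma> * (norm (s *\<^sub>C y) + 2) \<le> K * norm \<gamma> * 3"
          using K(1) by (intro mult_left_mono) auto
        then show "norm (\<Phi> (cdual_apply \<gamma>) (s *\<^sub>C y)) \<le> K * norm \<gamma> * 3"
          using K(2)[of \<gamma> "s *\<^sub>C y"] by linarith
      qed (use False in simp)
      then show ?thesis by (simp add: S_def mult_ac)
    qed simp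
  qed (use K in simp)
  have "clinear S"
  proof (rule clinearI)
    show "S (\<gamma> + \<delta>) = S \<gamma> + S \<delta>" for \<gamma> \<delta>
      by (simp add: S_def cdual_apply_add_abs HV_iso_add[OF iso] HV_cdual grad_add hol)
    show "S (c *\<^sub>C \<gamma>) = c *\<^sub>C S \<gamma>" for c \<gamma>
      by (simp add: S_def cdual_apply_scaleC_abs HV_iso_cmult[OF iso] HV_cdual grad_cmult hol)
  qed
  moreover from this have "bounded_linear S" using S_le by (rule clinear_bounded)
  ultimately show thesis
    by (rule that[of S "\<lambda>\<gamma>. \<Phi> (cdual_apply \<gamma>) 0"]) (rule ext, rule aff)
qed

text \<open>As \<open>\<Psi>\<close> fixes constants, \<open>\<gamma>\<close> equals
  \<open>R (S \<gamma>)\<close> up to an additive constant, and evaluation at 0 shows that this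
  constant vanishes.\<close>

lemma affine_inverse:
  assumes iso: "HV_iso \<Psi>"
    and \<Psi>\<Phi>: "\<And>\<gamma>. \<Psi> (\<Phi> (cdual_apply \<gamma>)) = cdual_apply \<gamma>"
    and \<Phi>: "\<And>\<gamma>. \<Phi> (cdual_apply \<gamma>) = (\<lambda>y. c \<gamma> + cdual_apply (S \<gamma>) y)"
    and \<Psi>: "\<And>\<delta>. \<Psi> (cdual_apply \<delta>) = (\<lambda>x. d \<delta> + cdual_apply (R \<delta>) x)"
  shows "R (S \<gamma>) = \<gamma>"
proof -
  have eq: "cdual_apply \<gamma> x = c \<gamma> + (d (S \<gamma>) + cdual_apply (R (S \<gamma>)) x)" for x
  proof -
    have "\<Psi> (\<Phi> (cdual_apply \<gamma>)) = (\<lambda>x. \<Psi> (\<lambda>y. c \<gamma>) x + \<Psi> (cdual_apply (S \<gamma>)) x)"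
      unfolding \<Phi> by (rule HV_iso_add[OF iso HV_const HV_cdual])
    then show ?thesis by (simp only: \<Psi>\<Phi> \<Psi> HV_iso_const[OF iso])
  qed
  from eq[of 0] have "c \<gamma> + d (S \<gamma>) = 0" by simp
  then have "cdual_apply \<gamma> x = cdual_apply (R (S \<gamma>)) x" for x
    using eq[of x] by (metis add.assoc add_0)
  then show ?thesis by (simp add: cdual_eq_iff)
qed

theorem HV_isomorphic_imp_dual_isomorphic:
  assumes "HV_isomorphic TYPE('a::complex_normed_vector) TYPE('b::complex_normed_vector)"
  shows "dual_isomorphic TYPE('a) TYPE('b)"
proof -
  obtain \<Phi> :: "('a \<Rightarrow> complex) \<Rightarrow> ('b \<Rightarrow> complex)" where iso: "HV_iso \<Phi>"
    using assms unfolding HV_isomorphic_def by blast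
  define \<Psi> where "\<Psi> = inv_into HV \<Phi>"
  have iso': "HV_iso \<Psi>" unfolding \<Psi>_def by (rule HV_iso_inverse[OF iso])
  have bij: "bij_betw \<Phi> HV HV" using iso by (simp add: HV_iso_def)
  obtain S c where S: "clinear S" "bounded_linear S"
      "\<And>\<gamma>. \<Phi> (cdual_apply \<gamma>) = (\<lambda>y. c \<gamma> + cdual_apply (S \<gamma>) y)"
    by (rule HV_iso_cdual_affine[OF iso]) (rule that)
  obtain R d where R: "clinear R" "bounded_linear R"
      "\<And>\<gamma>. \<Psi> (cdual_apply \<gamma>) = (\<lambda>y. d \<gamma> + cdual_apply (R \<gamma>) y)"
    by (rule HV_iso_cdual_affine[OF iso']) (rule that)
  have "R (S \<gamma>) = \<gamma>" for \<gamma>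
  proof (rule affine_inverse[where \<Phi> = \<Phi> and \<Psi> = \<Psi> and c = c and d = d and S = S and R = R])
    show "\<Psi> (\<Phi> (cdual_apply \<delta>)) = cdual_apply \<delta>" for \<delta>
      by (simp add: \<Psi>_def bij_betw_inv_into_left[OF bij] HV_cdual)
  qed (fact iso', fact S(3), fact R(3))
  moreover have "S (R \<gamma>) = \<gamma>" for \<gamma>
  proof (rule affine_inverse[where \<Phi> = \<Psi> and \<Psi> = \<Phi> and c = d and d = c and S = R and R = S])
    show "\<Phi> (\<Psi> (cdual_apply \<delta>)) = cdual_apply \<delta>" for \<delta>
      by (simp add: \<Psi>_def bij_betw_inv_into_right[OF bij] HV_cdual)
  qed (fact iso, fact R(3), fact S(3))
  ultimately have "homeomorphism UNIV UNIV S R"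
    using S(2) R(2) by (intro homeomorphismI) (simp_all add: linear_continuous_on)
  then show ?thesis unfolding dual_isomorphic_def using S(1) by blast
qed

section \<open>Arens regularity\<close>

lemma cdual_apply_sum: "cdual_apply (\<Sum>i\<in>I. \<phi> i) x = (\<Sum>i\<in>I. cdual_apply (\<phi> i) x)"
  by (induction I rule: infinite_finite_induct) (simp_all add: cdual_apply_zero cdual_apply_add)

lemma cdual_apply_arg_sum: "cdual_apply \<phi> (\<Sum>i\<in>I. x i) = (\<Sum>i\<in>I. cdual_apply \<phi> (x i))"
  by (induction I rule: infinite_finite_induct) (simp_all add: cdual_apply_arg_add)

lemma cmod_add_scaled_square:
  "(cmod (a + of_real t * b))\<^sup>2 = (cmod a)\<^sup>2 + 2 * t * Re (cnj a * b) + t\<^sup>2 * (cmod b)\<^sup>2"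
  by (simp only: cmod_power2) (simp add: power2_eq_square algebra_simps)

text \<open>An almost minimiser over the unit ball of the squared distance is almost a zero of it: otherwise
  the first-order condition would contradict \<open>norm z \<le> 1\<close>.\<close>

lemma goldstine:
  fixes \<phi> :: "'i \<Rightarrow> 'a::complex_normed_vector cdual" and z :: "'a cdual cdual"
  assumes fin: "finite I" and z: "norm z \<le> 1" and e: "e > 0"
  obtains x where "norm x \<le> 1" "\<And>i. i \<in> I \<Longrightarrow> norm (cdual_apply (\<phi> i) x - cdual_apply z (\<phi> i)) < e"
proof -
  define c where "c i = cdual_apply z (\<phi> i)" for i
  define Q where "Q x = (\<Sum>i\<in>I. (cmod (cdual_apply (\<phi> i) x - c i))\<^sup>2)" for x
  define M where "M = (\<Sum>i\<in>I. (norm (\<phi> i) * 2)\<^sup>2)"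
  have M0: "M \<ge> 0" by (simp add: M_def sum_nonneg)
  \<comment> \<open>\<open>t\<close> is the step length along segments starting at
    \<open>x0\<close>, and \<open>t\<^sup>2\<close> is the tolerance up to which \<open>x0\<close>
    minimises \<open>Q\<close>.\<close>
  define t where "t = min 1 (e\<^sup>2 / (1 + M))"
  have t: "0 < t" "t \<le> 1" using e M0 by (auto simp: t_def)
  have te: "t * (1 + M) / 2 < e\<^sup>2"
  proof -
    have "t * (1 + M) \<le> (e\<^sup>2 / (1 + M)) * (1 + M)" using M0 by (intro mult_right_mono) (auto simp: t_def)
    then have "t * (1 + M) \<le> e\<^sup>2" using M0 by simp
    moreover have "e\<^sup>2 > 0" using e by simp
    ultimately show ?thesis by linarith
  qed
  define A where "A = {x::'a. norm x \<le> 1}"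
  define m where "m = (INF x\<in>A. Q x)"
  have A0: "0 \<in> A" by (simp add: A_def)
  have bdd: "bdd_below (Q ` A)" by (intro bdd_belowI[of _ 0]) (auto simp: Q_def sum_nonneg)
  have m: "m \<le> Q x" if "x \<in> A" for x unfolding m_def by (rule cINF_lower[OF bdd that])
  have "m < m + t\<^sup>2" using t by simp
  then obtain x0 where x0: "x0 \<in> A" "Q x0 < m + t\<^sup>2"
    unfolding m_def using cINF_less_iff[OF _ bdd] A0 by blast
  define a where "a i = cdual_apply (\<phi> i) x0 - c i" for i
  \<comment> \<open>The derivative of \<open>Q\<close> at \<open>x0\<close> is
    \<open>2 * Re \<psi>\<close>. Near-minimality bounds \<open>norm \<psi>\<close> from above,
    \<open>norm z \<le> 1\<close> bounds it from below, and the difference of \<open>\<psi>\<close>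
    at \<open>x0\<close> and \<open>z\<close> at \<open>\<psi>\<close> is exactly
    \<open>Q x0\<close>.\<close>
  define \<psi> where "\<psi> = (\<Sum>i\<in>I. cnj (a i) *\<^sub>C \<phi> i)"
  have \<psi>: "cdual_apply \<psi> x = (\<Sum>i\<in>I. cnj (a i) * cdual_apply (\<phi> i) x)" for x
    by (simp add: \<psi>_def cdual_apply_sum cdual_apply_scaleC)
  have z\<psi>: "cdual_apply z \<psi> = (\<Sum>i\<in>I. cnj (a i) * c i)"
    by (simp add: \<psi>_def cdual_apply_arg_sum cdual_apply_arg_scaleC c_def)
  have "norm \<psi> \<le> t * (1 + M) / 2 - Re (cdual_apply \<psi> x0)"
  proof (rule cdual_norm_le_Re)
    fix x :: 'a assume x: "norm x \<le> 1"
    define y where "y = x0 + t *\<^sub>R (x - x0)"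
    define b where "b i = cdual_apply (\<phi> i) (x - x0)" for i
    have "y = (1 - t) *\<^sub>R x0 + t *\<^sub>R x" by (simp add: y_def algebra_simps)
    then have "norm y \<le> (1 - t) * norm x0 + t * norm x"
      using t norm_triangle_ineq[of "(1 - t) *\<^sub>R x0" "t *\<^sub>R x"] by simp
    also have "\<dots> \<le> (1 - t) * 1 + t * 1"
      using t x x0(1) by (intro add_mono mult_left_mono) (auto simp: A_def)
    finally have "y \<in> A" by (simp add: A_def)
    have "cdual_apply (\<phi> i) y - c i = a i + of_real t * b i" for i
      by (simp add: y_def a_def b_def cdual_apply_arg_add cdual_apply_arg_scaleR scaleR_conv_of_real)
    then have "Q y = (\<Sum>i\<in>I. (cmod (a i + of_real t * b i))\<^sup>2)"
      by (simp add: Q_def)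
    also have "\<dots> = Q x0 + 2 * t * Re (\<Sum>i\<in>I. cnj (a i) * b i) + t\<^sup>2 * (\<Sum>i\<in>I. (cmod (b i))\<^sup>2)"
      by (simp only: cmod_add_scaled_square)
        (simp add: Q_def a_def sum.distrib sum_distrib_left Re_sum)
    also have "(\<Sum>i\<in>I. (cmod (b i))\<^sup>2) \<le> M"
      unfolding M_def
    proof (intro sum_mono power_mono)
      fix i
      have "norm (x - x0) \<le> 2" using norm_triangle_ineq4[of x x0] x x0(1) by (simp add: A_def)
      then show "cmod (b i) \<le> norm (\<phi> i) * 2"
        unfolding b_def by (meson cdual_bound mult_left_mono norm_ge_zero order_trans)
    qed simp
    also have "(\<Sum>i\<in>I. cnj (a i) * b i) = cdual_apply \<psi> x - cdual_apply \<psi> x0"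
      by (simp add: \<psi> b_def cdual_apply_arg_diff right_diff_distrib sum_subtractf)
    finally have "m \<le> Q x0 + 2 * t * Re (cdual_apply \<psi> x - cdual_apply \<psi> x0) + t\<^sup>2 * M"
      using m[OF \<open>y \<in> A\<close>] t by simp
    then have "0 \<le> t * (2 * Re (cdual_apply \<psi> x - cdual_apply \<psi> x0) + t * (1 + M))"
      using x0(2) by (simp add: power2_eq_square algebra_simps)
    then show "- (t * (1 + M) / 2 - Re (cdual_apply \<psi> x0)) \<le> Re (cdual_apply \<psi> x)"
      using t by (simp add: zero_le_mult_iff)
  qed
  moreover have "- Re (cdual_apply z \<psi>) \<le> norm \<psi>"
  proof -
    have "- Re (cdual_apply z \<psi>) \<le> norm (cdual_apply z \<psi>)"
      using abs_Re_le_cmod[of "cdual_apply z \<psi>"] by linarith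
    also have "\<dots> \<le> norm z * norm \<psi>" by (rule cdual_bound)
    also have "\<dots> \<le> norm \<psi>" using z by (simp add: mult_left_le_one_le)
    finally show ?thesis .
  qed
  moreover have "cdual_apply \<psi> x0 - cdual_apply z \<psi> = (\<Sum>i\<in>I. a i * cnj (a i))"
    by (simp add: \<psi> z\<psi> a_def algebra_simps sum_subtractf sum.distrib)
  then have "cdual_apply \<psi> x0 - cdual_apply z \<psi> = of_real (Q x0)"
    by (simp only: Q_def a_def of_real_sum complex_norm_square)
  then have "Re (cdual_apply \<psi> x0) - Re (cdual_apply z \<psi>) = Q x0"
    by (metis Re_complex_of_real minus_complex.simps(1))
  ultimately have Qe: "Q x0 < e\<^sup>2" using te by linarith
  show thesis
  proof (rule that[of x0])
    show "norm x0 \<le> 1" using x0 by (simp add: A_def)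
    fix i assume "i \<in> I"
    then have "(cmod (cdual_apply (\<phi> i) x0 - c i))\<^sup>2 \<le> Q x0"
      unfolding Q_def using fin by (intro member_le_sum) auto
    then have "(cmod (cdual_apply (\<phi> i) x0 - c i))\<^sup>2 < e\<^sup>2" using Qe by simp
    then show "norm (cdual_apply (\<phi> i) x0 - cdual_apply z (\<phi> i)) < e"
      unfolding c_def using e by (simp add: power2_less_imp_less)
  qed
qed

section \<open>Adjoints, transposed forms and their extensions to the bidual\<close>

lemma precomp_clinear_left:
  assumes T: "clinear T" "bounded_linear T"
  shows "clinear (\<lambda>\<phi>. precomp \<phi> T)" "bounded_linear (\<lambda>\<phi>. precomp \<phi> T)"
proof -
  show *: "clinear (\<lambda>\<phi>. precomp \<phi> T)"
    by (rule clinearI) (simp_all add: cdual_eq_iff T cdual_apply_add cdual_apply_scaleC)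
  have "norm (precomp \<phi> T) \<le> onorm T * norm \<phi>" for \<phi>
  proof (rule cdual_norm_le)
    fix x
    have "norm (cdual_apply \<phi> (T x)) \<le> norm \<phi> * (onorm T * norm x)"
      using cdual_bound[of \<phi> "T x"] onorm[OF T(2), of x] by (meson mult_left_mono norm_ge_zero order_trans)
    then show "norm (cdual_apply (precomp \<phi> T) x) \<le> onorm T * norm \<phi> * norm x"
      by (simp add: T mult_ac)
  qed (simp add: onorm_pos_le[OF T(2)])
  then show "bounded_linear (\<lambda>\<phi>. precomp \<phi> T)" using * by (rule clinear_bounded[rotated])
qed

lemma clinear_compose: "clinear S \<Longrightarrow> clinear T \<Longrightarrow> clinear (\<lambda>x. S (T x))"
  by (simp add: clinear_iff)

lemma bidual_embed_clinear:
  shows "clinear (bidual_embed :: 'a::complex_normed_vector \<Rightarrow> _)"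
    and "bounded_linear (bidual_embed :: 'a \<Rightarrow> _)"
proof -
  show *: "clinear (bidual_embed :: 'a \<Rightarrow> _)"
    by (rule clinearI)
      (simp_all add: cdual_eq_iff cdual_apply_add cdual_apply_scaleC cdual_apply_arg_add cdual_apply_arg_scaleC)
  have "norm (bidual_embed x) \<le> 1 * norm x" for x :: 'a
    by (rule cdual_norm_le) (simp_all, metis cdual_bound mult.commute)
  then show "bounded_linear (bidual_embed :: 'a \<Rightarrow> _)" using * by (rule clinear_bounded[rotated])
qed

text \<open>The operator of the transposed bilinear form, obtained as the adjoint of
  \<open>T\<close> restricted to the canonical image of \<open>'b\<close>.\<close>

definition flip_op :: "('a::complex_normed_vector \<Rightarrow> 'b::complex_normed_vector cdual) \<Rightarrow> 'b \<Rightarrow> 'a cdual"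
  where "flip_op T y = precomp (bidual_embed y) T"

lemma flip_op_apply:
  "clinear T \<Longrightarrow> bounded_linear T \<Longrightarrow> cdual_apply (flip_op T y) x = cdual_apply (T x) y"
  by (simp add: flip_op_def)

lemma flip_op_clinear:
  assumes T: "clinear T" "bounded_linear T"
  shows "clinear (flip_op T)" "bounded_linear (flip_op T)"
  unfolding flip_op_def[abs_def]
  using clinear_compose[OF precomp_clinear_left(1)[OF T] bidual_embed_clinear(1)]
    bounded_linear_compose[OF precomp_clinear_left(2)[OF T] bidual_embed_clinear(2)] by auto

text \<open>Weak compactness makes the second adjoint of \<open>T\<close> take values in the dual:
  for fixed \<open>z\<close> the right factor is evaluation of \<open>w\<close> at a point
  \<open>\<gamma>\<close>. Embedded points \<open>w\<close> then identify it as
  \<open>precomp z (flip_op T)\<close>.\<close>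

lemma weakly_compact_op_Arens:
  fixes T :: "'a::complex_normed_vector \<Rightarrow> 'b::complex_normed_vector cdual"
  assumes T: "clinear T" "bounded_linear T" and wc: "weakly_compact_op T"
  shows "cdual_apply z (precomp w T) = cdual_apply w (precomp z (flip_op T))"
proof -
  have unit: "\<exists>\<gamma>. \<forall>w. cdual_apply w \<gamma> = cdual_apply z (precomp w T)" if z: "norm z \<le> 1" for z
  proof (rule ccontr)
    \<comment> \<open>Without such a point the weakly open sets \<open>N p\<close> cover the compact
      set \<open>K\<close>. For the finitely many functionals of a subcover,
      \<open>goldstine\<close> finds an \<open>x\<close> with \<open>T x\<close> in \<open>K\<close>
      but in none of them.\<close>
    assume neg: "\<not> (\<exists>\<gamma>. \<forall>w. cdual_apply w \<gamma> = cdual_apply z (precomp w T))"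
    define K where "K = weak_topology closure_of (T ` cball 0 1)"
    have K: "compactin weak_topology K" using wc by (simp add: weakly_compact_op_def K_def)
    define N where "N p = cdual_apply (fst p) -` {c. snd p < cmod (c - cdual_apply z (precomp (fst p) T))}"
      for p :: "'b cdual cdual \<times> real"
    have "openin weak_topology (N p)" for p
    proof -
      have "open {c. snd p < cmod (c - cdual_apply z (precomp (fst p) T))}"
        by (intro open_Collect_less continuous_intros)
      then show ?thesis unfolding weak_topology_def N_def
        by (intro topology_generated_by_Basis) blast
    qed
    moreover have "K \<subseteq> \<Union> (N ` {p. snd p > 0})"
    proof
      fix \<gamma> assume "\<gamma> \<in> K"
      obtain w where w: "cdual_apply w \<gamma> \<noteq> cdual_apply z (precomp w T)" using neg by blast
      define d where "d = cmod (cdual_apply w \<gamma> - cdual_apply z (precomp w T))"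
      have "d > 0" using w by (simp add: d_def)
      then have "\<gamma> \<in> N (w, d / 2)" "(w, d / 2) \<in> {p. snd p > 0}" by (auto simp: N_def d_def)
      then show "\<gamma> \<in> \<Union> (N ` {p. snd p > 0})" by blast
    qed
    ultimately obtain \<F> where \<F>: "finite \<F>" "\<F> \<subseteq> N ` {p. snd p > 0}" "K \<subseteq> \<Union>\<F>"
      using K unfolding compactin_def by (metis (no_types, lifting) imageE)
    then obtain P where P: "finite P" "P \<subseteq> {p. snd p > 0}" "\<F> = N ` P"
      by (meson finite_subset_image)
    define e where "e = Min (insert 1 (snd ` P))"
    have e: "e > 0" using P by (auto simp: e_def)
    have e_le: "e \<le> snd p" if "p \<in> P" for p using P that by (auto simp: e_def)
    obtain x where x: "norm x \<le> 1"
      "\<And>p. p \<in> P \<Longrightarrow> norm (cdual_apply (precomp (fst p) T) x - cdual_apply z (precomp (fst p) T)) < e"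
      using goldstine[OF P(1) z e, of "\<lambda>p. precomp (fst p) T"] by blast
    have "T x \<in> K"
      unfolding K_def by (rule subsetD[OF closure_of_subset]) (use x(1) in auto)
    then obtain p where "p \<in> P" "T x \<in> N p" using \<F> P by blast
    then show False using x(2)[of p] e_le[of p] by (simp add: N_def T)
  qed
  \<comment> \<open>Scaling by \<open>s\<close> brings \<open>z\<close> into the unit ball,
    including the case \<open>z = 0\<close>.\<close>
  define s where "s = 1 / (1 + norm z)"
  have s: "s > 0" unfolding s_def by (simp add: add_pos_nonneg)
  have "norm (of_real s *\<^sub>C z) = s * norm z" using s by (simp add: norm_scaleC)
  also have "\<dots> \<le> 1" by (simp add: s_def divide_le_eq add_pos_nonneg)
  finally obtain \<gamma> where "\<And>w. cdual_apply w \<gamma> = cdual_apply (of_real s *\<^sub>C z) (precomp w T)"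
    using unit by blast
  then have \<gamma>: "cdual_apply w ((1 / of_real s) *\<^sub>C \<gamma>) = cdual_apply z (precomp w T)" for w
    using s by (simp add: cdual_apply_arg_scaleC cdual_apply_scaleC)
  have "(1 / of_real s) *\<^sub>C \<gamma> = precomp z (flip_op T)"
    unfolding cdual_eq_iff using \<gamma>[of "bidual_embed _"] by (simp add: flip_op_clinear T flip_op_def)
  then show ?thesis using \<gamma> by simp
qed

text \<open>For \<open>T\<close> read as a symmetric bilinear form, the two expressions are its
  iterated extensions to the bidual. In this shape regularity enters the calculus of
  \<open>bdir\<close>.\<close>

definition Arens_symmetric :: "'a::complex_normed_vector itself \<Rightarrow> bool"
  where "Arens_symmetric _ \<longleftrightarrow> (\<forall>T :: 'a \<Rightarrow> 'a cdual. clinear T \<and> bounded_linear T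
       \<and> (\<forall>x y. cdual_apply (T x) y = cdual_apply (T y) x) \<longrightarrow>
       (\<forall>z w. cdual_apply z (precomp w T) = cdual_apply w (precomp z T)))"

lemma flip_op_symmetric:
  assumes "clinear T" "bounded_linear T" "\<And>x y. cdual_apply (T x) y = cdual_apply (T y) x"
  shows "flip_op T = T"
  using assms by (simp add: fun_eq_iff cdual_eq_iff flip_op_apply)

lemma symmetrically_regular_Arens:
  assumes "symmetrically_regular_banach TYPE('a::complex_banach)"
  shows "Arens_symmetric TYPE('a)"
  unfolding Arens_symmetric_def
proof (intro allI impI, elim conjE)
  fix T :: "'a \<Rightarrow> 'a cdual" and z w
  assume T: "clinear T" "bounded_linear T" "\<forall>x y. cdual_apply (T x) y = cdual_apply (T y) x"
  then have "weakly_compact_op T"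
    using assms by (simp add: symmetrically_regular_banach_def linear_continuous_on)
  from weakly_compact_op_Arens[OF T(1,2) this, of z w]
  show "cdual_apply z (precomp w T) = cdual_apply w (precomp z T)"
    using T by (simp add: flip_op_symmetric)
qed

lemma regular_imp_symmetrically_regular:
  "regular_banach TYPE('a::complex_banach) \<Longrightarrow> symmetrically_regular_banach TYPE('a)"
  by (simp add: regular_banach_def symmetrically_regular_banach_def)

text \<open>The form of \<open>T\<close>, extended to the bidual of \<open>'b\<close>, is pulled
  back to \<open>'a\<close> along \<open>\<sigma>\<close>, the adjoint of \<open>R\<close>
  restricted to \<open>'a\<close>. The resulting \<open>U\<close> is not known to be symmetric,
  hence full regularity. The interchange of extensions for \<open>U\<close> is then pushed forward
  by \<open>S\<close>.\<close>

lemma regular_dual_Arens: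
  fixes S :: "'a::complex_banach cdual \<Rightarrow> 'b::complex_normed_vector cdual"
  assumes reg: "regular_banach TYPE('a)"
    and S: "clinear S" "bounded_linear S" and R: "clinear R" "bounded_linear R"
    and SR: "\<And>\<delta>. S (R \<delta>) = \<delta>"
  shows "Arens_symmetric TYPE('b)"
  unfolding Arens_symmetric_def
proof (intro allI impI, elim conjE)
  fix T :: "'b \<Rightarrow> 'b cdual" and z w
  assume T: "clinear T" "bounded_linear T" and sym: "\<forall>x y. cdual_apply (T x) y = cdual_apply (T y) x"
  define \<sigma> where "\<sigma> x = precomp (bidual_embed x) R" for x :: 'a
  have \<sigma>: "clinear \<sigma>" "bounded_linear \<sigma>"
    unfolding \<sigma>_def[abs_def]
    using clinear_compose[OF precomp_clinear_left(1)[OF R] bidual_embed_clinear(1)]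
      bounded_linear_compose[OF precomp_clinear_left(2)[OF R] bidual_embed_clinear(2)] by auto
  have \<sigma>_apply: "cdual_apply (\<sigma> x) \<delta> = cdual_apply (R \<delta>) x" for x \<delta> by (simp add: \<sigma>_def R)
  define U where "U x = R (precomp (\<sigma> x) T)" for x
  have U: "clinear U" "bounded_linear U"
    unfolding U_def[abs_def]
    using clinear_compose[OF R(1) clinear_compose[OF precomp_clinear_left(1)[OF T] \<sigma>(1)]]
      bounded_linear_compose[OF R(2) bounded_linear_compose[OF precomp_clinear_left(2)[OF T] \<sigma>(2)]] by auto
  have "weakly_compact_op U" using reg U by (simp add: regular_banach_def linear_continuous_on)
  note AU = weakly_compact_op_Arens[OF U this]
  have wU: "cdual_apply (precomp (precomp w S) U) x = cdual_apply w (precomp (\<sigma> x) T)" for w x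
    by (simp add: U S) (simp add: U_def SR)
  \<comment> \<open>At an embedded point \<open>y\<close> the extension of \<open>U\<close>
    collapses to \<open>R (T y)\<close>, and \<open>AU\<close> moves \<open>z\<close> across
    it.\<close>
  have A: "S (precomp (precomp z S) (flip_op U)) = precomp z T" for z
    unfolding cdual_eq_iff
  proof
    fix y
    have "precomp (precomp (bidual_embed y) S) U = R (T y)"
      unfolding cdual_eq_iff by (simp add: wU T \<sigma>_apply)
    then show "cdual_apply (S (precomp (precomp z S) (flip_op U))) y = cdual_apply (precomp z T) y"
      using AU[of "precomp z S" "precomp (bidual_embed y) S"] by (simp add: S T SR)
  qed
  have B: "cdual_apply z (S (precomp (precomp w S) U)) = cdual_apply w (precomp z T)" for z w
    using AU[of "precomp z S" "precomp w S"] by (simp add: S A)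
  \<comment> \<open>Testing \<open>B\<close> on embedded points identifies the other extension as
    well; here the symmetry of \<open>T\<close> enters.\<close>
  have "S (precomp (precomp w S) U) = precomp w T"
    unfolding cdual_eq_iff using B[of "bidual_embed _" w] sym
    by (simp add: T flip_op_symmetric flip: flip_op_def)
  then show "cdual_apply z (precomp w T) = cdual_apply w (precomp z T)" using B[of z w] by simp
qed

section \<open>Binomial sums of exponential type\<close>

lemma exp_sums_real: "(\<lambda>n. a ^ n / fact n) sums exp (a::real)"
  using exp_converges[of a] by (simp add: scaleR_conv_of_real divide_inverse mult.commute)

text \<open>The terms \<open>P k l / (k! l!)\<close> are dominated by a product of two exponential
  series, so the double series may be summed by rows or along antidiagonals; the latter give the
  binomial sums.\<close>

lemma exp_double_sums:
  fixes P :: "nat \<Rightarrow> nat \<Rightarrow> complex"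
  assumes bd: "\<And>k l. norm (P k l) \<le> C * a ^ k * b ^ l" and ab: "a \<ge> 0" "b \<ge> 0"
    and A: "\<And>l. (\<lambda>k. P k l / fact k) sums A l"
    and S: "(\<lambda>n. (\<Sum>k\<le>n. of_nat (n choose k) * P k (n - k)) / fact n) sums S"
  shows "(\<lambda>l. A l / fact l) sums S"
proof -
  define c where "c = (\<lambda>(l, k). P k l / (fact k * fact l))"
  have "norm (P 0 0) \<le> C" using bd[of 0 0] by simp
  then have C: "C \<ge> 0" using norm_ge_zero order_trans by blast
  define g where "g = (\<lambda>(l, k). C * (a ^ k / fact k) * (b ^ l / fact l))"
  have gk: "((\<lambda>k. g (l, k)) has_sum (C * (b ^ l / fact l)) * exp a) UNIV" for l
    using sums_nonneg_imp_has_sum[OF sums_mult[OF exp_sums_real, of "C * (b ^ l / fact l)" a]] C ab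
    by (simp add: g_def mult_ac)
  have gl: "((\<lambda>l. C * (b ^ l / fact l) * exp a) has_sum (C * exp a) * exp b) UNIV"
    using sums_nonneg_imp_has_sum[OF sums_mult[OF exp_sums_real, of "C * exp a" b]] C ab
    by (simp add: mult_ac)
  have g0: "g p \<ge> 0" for p using C ab by (auto simp: g_def split: prod.split)
  have "(\<lambda>p. norm (g p)) summable_on Sigma UNIV (\<lambda>_. UNIV)"
    unfolding Infinite_Sum.abs_summable_on_Sigma_iff
  proof (intro conjI ballI)
    show "(\<lambda>k. norm (g (l, k))) summable_on UNIV" for l
      using has_sum_imp_summable[OF gk] g0 by simp
    have "infsum (\<lambda>k. norm (g (l, k))) UNIV = C * (b ^ l / fact l) * exp a" for l
      using gk[of l] g0 by (simp add: infsumI)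
    then show "(\<lambda>l. norm (infsum (\<lambda>k. norm (g (l, k))) UNIV)) summable_on UNIV"
      using has_sum_imp_summable[OF gl] C ab by simp
  qed
  then have abs: "(\<lambda>p. norm (c p)) summable_on Sigma UNIV (\<lambda>_. UNIV)"
  proof (rule Infinite_Sum.abs_summable_on_comparison_test)
    fix p :: "nat \<times> nat"
    obtain l k where p: "p = (l, k)" by (cases p)
    have "norm (c p) = norm (P k l) / (fact k * fact l)" by (simp add: c_def p norm_divide norm_mult)
    also have "\<dots> \<le> (C * a ^ k * b ^ l) / (fact k * fact l)" by (intro divide_right_mono bd) simp
    also have "\<dots> = norm (g p)" using C ab by (simp add: g_def p)
    finally show "norm (c p) \<le> norm (g p)" .
  qed
  from abs_summable_summable[OF this]
  obtain T where T: "(c has_sum T) (Sigma UNIV (\<lambda>_. UNIV))"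
    unfolding summable_on_def by blast
  have inner: "((\<lambda>k. c (l, k)) has_sum A l / fact l) UNIV" for l
  proof -
    have "(\<lambda>k. norm (c (l, k))) summable_on UNIV"
      using abs unfolding Infinite_Sum.abs_summable_on_Sigma_iff by simp
    from abs_summable_summable[OF this]
    obtain B where B: "((\<lambda>k. c (l, k)) has_sum B) UNIV"
      unfolding summable_on_def by blast
    have "(\<lambda>k. c (l, k)) sums (A l / fact l)"
      using sums_divide[OF A[of l], of "fact l"] by (simp add: c_def)
    with has_sum_imp_sums[OF B] have "B = A l / fact l" by (rule sums_unique2)
    then show ?thesis using B by simp
  qed
  have 1: "(\<lambda>l. A l / fact l) sums T"
    by (rule has_sum_imp_sums, rule has_sum_SigmaD[OF T]) (use inner in auto)
  \<comment> \<open>For fixed \<open>n\<close>, the pairs \<open>(n - k, k)\<close> run through the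
    antidiagonal \<open>l + k = n\<close>.\<close>
  have bij: "bij_betw (\<lambda>(n, k). (n - k, k)) (Sigma UNIV (\<lambda>n::nat. {..n})) (Sigma UNIV (\<lambda>_. UNIV))"
    by (rule bij_betw_byWitness[where f' = "\<lambda>(l, k). (l + k, k)"]) auto
  have T': "((\<lambda>p. c ((\<lambda>(n, k). (n - k, k)) p)) has_sum T) (Sigma UNIV (\<lambda>n::nat. {..n}))"
    using has_sum_reindex_bij_betw[OF bij, of c T] T by blast
  have "((\<lambda>k. c (n - k, k)) has_sum (\<Sum>k\<le>n. of_nat (n choose k) * P k (n - k)) / fact n) {..n}" for n
  proof -
    have "(\<Sum>k\<le>n. c (n - k, k)) = (\<Sum>k\<le>n. of_nat (n choose k) * P k (n - k) / fact n)"
      by (rule sum.cong) (simp_all add: c_def binomial_fact)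
    then show ?thesis using has_sum_finite[of "{..n}" "\<lambda>k. c (n - k, k)"]
      by (simp add: sum_divide_distrib)
  qed
  then have "(\<lambda>n. (\<Sum>k\<le>n. of_nat (n choose k) * P k (n - k)) / fact n) sums T"
    by (intro has_sum_imp_sums has_sum_SigmaD[OF T']) auto
  with S have "S = T" by (rule sums_unique2)
  then show ?thesis using 1 by simp
qed


section \<open>Differentiation along the bidual\<close>

definition bdir :: "'a::complex_normed_vector cdual cdual \<Rightarrow> ('a \<Rightarrow> complex) \<Rightarrow> 'a \<Rightarrow> complex"
  where "bdir z f x = cdual_apply z (grad f x)"

lemma HV_bounded_type:
  assumes "f \<in> HV" shows "bounded_type f"
  unfolding bounded_type_def
proof (intro conjI allI HV_holomorphic[OF assms])
  fix r
  have "norm (f x) \<le> HV_seminorm 1 f * exp r" if "norm x \<le> r" for x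
  proof -
    have "norm (f x) \<le> HV_seminorm 1 f * exp (norm x / real 1)" by (rule HV_bound[OF assms]) simp
    also have "\<dots> \<le> HV_seminorm 1 f * exp r"
      using that HV_seminorm_nonneg[OF assms, of 1] by (intro mult_left_mono) auto
    finally show ?thesis .
  qed
  then show "\<exists>M. \<forall>x. norm x \<le> r \<longrightarrow> norm (f x) \<le> M" by blast
qed

text \<open>One second derivative \<open>T\<close> serves all directions \<open>z\<close>, so that
  \<open>bdir_commute\<close> can compare two iterated derivations on a single form.\<close>

lemma bdir_has_derivative:
  assumes "bounded_type f"
  obtains T where "clinear T" "bounded_linear T" "\<And>h k. cdual_apply (T h) k = cdual_apply (T k) h"
    "\<And>z. (bdir z f has_derivative cdual_apply (precomp z T)) (at x)"
proof -
  obtain T where T: "clinear T" "bounded_linear T" "\<And>h k. cdual_apply (T h) k = cdual_apply (T k) h"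
    "(grad f has_derivative T) (at x)"
    using has_derivative_of_grad[OF assms] by blast
  have "(bdir z f has_derivative cdual_apply (precomp z T)) (at x)" for z
  proof -
    have "((\<lambda>x. cdual_apply z (grad f x)) has_derivative (\<lambda>h. cdual_apply z (T h))) (at x)"
      by (rule has_derivative_compose[OF T(4) has_derivative_cdual_apply])
    moreover have "cdual_apply (precomp z T) = (\<lambda>h. cdual_apply z (T h))"
      by (simp add: fun_eq_iff T(1,2))
    ultimately show ?thesis by (simp add: bdir_def[abs_def])
  qed
  with T(1-3) show thesis by (rule that)
qed

lemma bdir_holomorphic:
  assumes "bounded_type f" shows "holomorphic_fun (bdir z f)"
  unfolding holomorphic_fun_def
proof
  fix x
  show "\<exists>D. clinear D \<and> (bdir z f has_derivative D) (at x)"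
  proof (rule bdir_has_derivative[OF assms, of x])
    fix T assume "\<And>z. (bdir z f has_derivative cdual_apply (precomp z T)) (at x)"
    then show ?thesis using clinear_cdual_apply by (intro exI conjI)
  qed
qed

text \<open>Cauchy's estimate on a ball of radius \<open>m\<close>: across it the weight
  \<open>exp (norm x / m)\<close> grows at most by the factor \<open>exp 1\<close>, and the radius
  supplies the denominator.\<close>

lemma norm_grad_HV_le:
  assumes f: "f \<in> HV" and m: "1 \<le> m"
  shows "norm (grad f x) \<le> exp 1 / real m * HV_seminorm m f * exp (norm x / real m)"
proof -
  have "norm (grad f x) \<le> (HV_seminorm m f * exp (norm x / real m + 1)) / real m"
  proof (rule norm_grad_le[OF HV_holomorphic[OF f]])
    fix y assume y: "norm (y - x) \<le> real m"
    have "norm y \<le> norm x + real m" using y norm_triangle_sub[of y x] by linarith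
    then have "norm y / real m \<le> norm x / real m + 1" using m by (simp add: field_simps)
    then have "HV_seminorm m f * exp (norm y / real m) \<le> HV_seminorm m f * exp (norm x / real m + 1)"
      using HV_seminorm_nonneg[OF f m] by (intro mult_left_mono) auto
    then show "norm (f y) \<le> HV_seminorm m f * exp (norm x / real m + 1)"
      using HV_bound[OF f m, of y] by linarith
  qed (use m in simp)
  then show ?thesis by (simp add: exp_add mult_ac)
qed

lemma norm_bdir_le:
  assumes f: "f \<in> HV" and m: "1 \<le> m"
  shows "norm (bdir z f x) \<le> (exp 1 * norm z / real m * HV_seminorm m f) * exp (norm x / real m)"
proof -
  have "norm (bdir z f x) \<le> norm z * norm (grad f x)" unfolding bdir_def by (rule cdual_bound)
  also have "\<dots> \<le> norm z * (exp 1 / real m * HV_seminorm m f * exp (norm x / real m))"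
    by (intro mult_left_mono norm_grad_HV_le f m) simp
  finally show ?thesis by (simp add: mult_ac)
qed

lemma bdir_HV: assumes "f \<in> HV" shows "bdir z f \<in> HV"
  unfolding HV_iff using bdir_holomorphic[OF HV_bounded_type[OF assms]] norm_bdir_le[OF assms] by blast

lemma HV_seminorm_bdir: "f \<in> HV \<Longrightarrow> 1 \<le> m \<Longrightarrow>
    HV_seminorm m (bdir z f) \<le> exp 1 * norm z / real m * HV_seminorm m f"
  by (intro HV_seminorm_le norm_bdir_le)

lemma bdir_add: "f \<in> HV \<Longrightarrow> g \<in> HV \<Longrightarrow> bdir z (\<lambda>x. f x + g x) = (\<lambda>x. bdir z f x + bdir z g x)"
  by (simp add: bdir_def[abs_def] grad_add HV_holomorphic cdual_apply_arg_add)

lemma bdir_cmult: "f \<in> HV \<Longrightarrow> bdir z (\<lambda>x. c * f x) = (\<lambda>x. c * bdir z f x)"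
  by (simp add: bdir_def[abs_def] grad_cmult HV_holomorphic cdual_apply_arg_scaleC)

lemma bdir_mult: "f \<in> HV \<Longrightarrow> g \<in> HV \<Longrightarrow>
    bdir z (\<lambda>x. f x * g x) = (\<lambda>x. bdir z f x * g x + f x * bdir z g x)"
  by (simp add: bdir_def[abs_def] grad_mult HV_holomorphic cdual_apply_arg_add cdual_apply_arg_scaleC mult_ac add_ac)

lemma bdir_add_direction: "bdir (z + w) f = (\<lambda>x. bdir z f x + bdir w f x)"
  by (simp add: bdir_def[abs_def] cdual_apply_add)

text \<open>The gradient of \<open>bdir w f\<close> at \<open>x\<close> is the adjoint of the second
  derivative \<open>T\<close> at \<open>w\<close>, so the two sides are the two extensions of the
  symmetric form \<open>T\<close>.\<close>

lemma bdir_commute: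
  fixes f :: "'a::complex_normed_vector \<Rightarrow> complex"
  assumes ar: "Arens_symmetric TYPE('a)" and f: "f \<in> HV"
  shows "bdir z (bdir w f) = bdir w (bdir z f)"
proof
  fix x
  obtain T where T: "clinear T" "bounded_linear T" "\<And>h k. cdual_apply (T h) k = cdual_apply (T k) h"
    "\<And>z. (bdir z f has_derivative cdual_apply (precomp z T)) (at x)"
    using bdir_has_derivative[OF HV_bounded_type[OF f]] by blast
  have "grad (bdir z f) x = precomp z T" for z by (rule grad_eqI[OF T(4)])
  then show "bdir z (bdir w f) x = bdir w (bdir z f) x"
    using ar T(1-3) unfolding Arens_symmetric_def bdir_def by metis
qed

lemma bdir_pow_HV: "f \<in> HV \<Longrightarrow> (bdir z ^^ n) f \<in> HV"
  by (induction n) (simp_all add: bdir_HV)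

lemma HV_seminorm_bdir_pow:
  assumes f: "f \<in> HV" and m: "1 \<le> m"
  shows "HV_seminorm m ((bdir z ^^ n) f) \<le> (exp 1 * norm z / real m) ^ n * HV_seminorm m f"
proof (induction n)
  case (Suc n)
  have "HV_seminorm m ((bdir z ^^ Suc n) f) \<le> exp 1 * norm z / real m * HV_seminorm m ((bdir z ^^ n) f)"
    unfolding funpow.simps o_apply by (rule HV_seminorm_bdir[OF bdir_pow_HV[OF f] m])
  also have "\<dots> \<le> exp 1 * norm z / real m * ((exp 1 * norm z / real m) ^ n * HV_seminorm m f)"
    by (intro mult_left_mono Suc) simp
  finally show ?case by (simp add: mult.assoc)
qed simp

lemma norm_bdir_pow_0:
  fixes f :: "'a::complex_normed_vector \<Rightarrow> complex"
  assumes f: "f \<in> HV" and m: "1 \<le> m"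
  shows "norm ((bdir z ^^ n) f 0) \<le> (exp 1 * norm z / real m) ^ n * HV_seminorm m f"
proof -
  have "norm ((bdir z ^^ n) f 0) \<le> HV_seminorm m ((bdir z ^^ n) f) * exp (norm (0::'a) / real m)"
    by (rule HV_bound[OF bdir_pow_HV[OF f] m])
  then have "norm ((bdir z ^^ n) f 0) \<le> HV_seminorm m ((bdir z ^^ n) f)" by simp
  also have "\<dots> \<le> (exp 1 * norm z / real m) ^ n * HV_seminorm m f"
    by (rule HV_seminorm_bdir_pow[OF f m])
  finally show ?thesis .
qed

lemma bdir_pow_add: "f \<in> HV \<Longrightarrow> g \<in> HV \<Longrightarrow>
    (bdir z ^^ n) (\<lambda>x. f x + g x) = (\<lambda>x. (bdir z ^^ n) f x + (bdir z ^^ n) g x)"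
  by (induction n) (simp_all add: bdir_add bdir_pow_HV)

lemma bdir_pow_cmult: "f \<in> HV \<Longrightarrow> (bdir z ^^ n) (\<lambda>x. c * f x) = (\<lambda>x. c * (bdir z ^^ n) f x)"
  by (induction n) (simp_all add: bdir_cmult bdir_pow_HV)

lemma bdir_pow_commute:
  fixes f :: "'a::complex_normed_vector \<Rightarrow> complex"
  assumes ar: "Arens_symmetric TYPE('a)" and f: "f \<in> HV"
  shows "bdir w ((bdir z ^^ n) f) = (bdir z ^^ n) (bdir w f)"
proof (induction n)
  case (Suc n)
  have "bdir w ((bdir z ^^ Suc n) f) = bdir z (bdir w ((bdir z ^^ n) f))"
    by (simp add: bdir_commute[OF ar bdir_pow_HV[OF f]])
  then show ?case using Suc by simp
qed simp

lemma HV_sum: "(\<And>i. i \<in> I \<Longrightarrow> f i \<in> HV) \<Longrightarrow> (\<lambda>x. \<Sum>i\<in>I. f i x) \<in> HV"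
  by (induction I rule: infinite_finite_induct) (simp_all add: HV_const HV_add)

lemma bdir_sum: "finite I \<Longrightarrow> (\<And>i. i \<in> I \<Longrightarrow> f i \<in> HV) \<Longrightarrow>
    bdir z (\<lambda>x. \<Sum>i\<in>I. f i x) = (\<lambda>x. \<Sum>i\<in>I. bdir z (f i) x)"
proof (induction I rule: finite_induct)
  case empty
  then show ?case using bdir_cmult[OF HV_const, of z 0] by simp
next
  case (insert i I)
  then show ?case by (simp add: bdir_add HV_sum)
qed

text \<open>Pascal's rule in summed form, the induction step of
  \<open>bdir_pow_binomial\<close>.\<close>

lemma sum_binomial_Suc:
  fixes a b :: "nat \<Rightarrow> 'a::comm_ring_1"
  assumes "\<And>k. k \<le> n \<Longrightarrow> b k = a (Suc k) + a k"
  shows "(\<Sum>k\<le>n. of_nat (n choose k) * b k) = (\<Sum>k\<le>Suc n. of_nat (Suc n choose k) * a k)"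
proof -
  have "(\<Sum>k\<le>Suc n. of_nat (Suc n choose k) * a k)
      = a 0 + (\<Sum>k\<le>n. of_nat (n choose k) * a (Suc k)) + (\<Sum>k\<le>n. of_nat (n choose Suc k) * a (Suc k))"
    by (simp add: sum.atMost_Suc_shift distrib_right sum.distrib del: sum.atMost_Suc)
  moreover have "a 0 + (\<Sum>k\<le>n. of_nat (n choose Suc k) * a (Suc k)) = (\<Sum>k\<le>Suc n. of_nat (n choose k) * a k)"
    by (simp add: sum.atMost_Suc_shift del: sum.atMost_Suc)
  moreover have "(\<Sum>k\<le>Suc n. of_nat (n choose k) * a k) = (\<Sum>k\<le>n. of_nat (n choose k) * a k)"
    by (simp add: binomial_eq_0)
  ultimately show ?thesis using assms by (simp add: distrib_left sum.distrib)
qed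

text \<open>Both the Leibniz rule and the binomial theorem for commuting derivations are instances.\<close>

lemma bdir_pow_binomial:
  assumes P: "\<And>k l. P k l \<in> HV"
    and step: "\<And>k l. bdir z (P k l) = (\<lambda>x. P (Suc k) l x + P k (Suc l) x)"
  shows "(bdir z ^^ n) (P 0 0) = (\<lambda>x. \<Sum>k\<le>n. of_nat (n choose k) * P k (n - k) x)"
proof (induction n)
  case (Suc n)
  have "(bdir z ^^ Suc n) (P 0 0) = bdir z (\<lambda>x. \<Sum>k\<le>n. of_nat (n choose k) * P k (n - k) x)"
    using Suc by simp
  also have "\<dots> = (\<lambda>x. \<Sum>k\<le>n. of_nat (n choose k) * (P (Suc k) (n - k) x + P k (Suc (n - k)) x))"
    by (simp add: bdir_sum HV_cmult P bdir_cmult step)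
  also have "\<dots> = (\<lambda>x. \<Sum>k\<le>Suc n. of_nat (Suc n choose k) * P k (Suc n - k) x)"
    by (rule ext, rule sum_binomial_Suc) (simp add: Suc_diff_le)
  finally show ?case .
qed simp


section \<open>The Aron-Berner extension\<close>

definition bext :: "('a::complex_normed_vector \<Rightarrow> complex) \<Rightarrow> 'a cdual cdual \<Rightarrow> complex"
  where "bext f z = (\<Sum>n. (bdir z ^^ n) f 0 / fact n)"

lemma norm_bext_term:
  assumes f: "f \<in> HV" and m: "1 \<le> m"
  shows "norm ((bdir z ^^ n) f 0 / fact n) \<le> (exp 1 * norm z / real m) ^ n / fact n * HV_seminorm m f"
proof -
  have "norm ((bdir z ^^ n) f 0) / fact n \<le> (exp 1 * norm z / real m) ^ n * HV_seminorm m f / fact n"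
    by (intro divide_right_mono norm_bdir_pow_0[OF f m]) simp
  then show ?thesis by (simp add: norm_divide)
qed

lemma bext_sums:
  assumes f: "f \<in> HV"
  shows "(\<lambda>n. (bdir z ^^ n) f 0 / fact n) sums bext f z"
proof -
  have "summable (\<lambda>n. (exp 1 * norm z / real 1) ^ n / fact n * HV_seminorm 1 f)"
    by (intro summable_mult2 sums_summable[OF exp_sums_real])
  from summable_comparison_test'[OF this norm_bext_term[OF f]]
  show ?thesis unfolding bext_def by (intro summable_sums) simp
qed

text \<open>Since \<open>m\<close> is free, the exponent can be made as small as desired: the
  extension is again of zero exponential type.\<close>

lemma norm_bext_le:
  assumes f: "f \<in> HV" and m: "1 \<le> m"
  shows "norm (bext f z) \<le> exp (exp 1 * norm z / real m) * HV_seminorm m f"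
proof -
  have s: "(\<lambda>n. (exp 1 * norm z / real m) ^ n / fact n * HV_seminorm m f)
      sums (exp (exp 1 * norm z / real m) * HV_seminorm m f)"
    by (rule sums_mult2[OF exp_sums_real])
  show ?thesis
    unfolding bext_def sums_unique[OF s]
    by (rule norm_suminf_le[OF norm_bext_term[OF f m] sums_summable[OF s]])
qed

lemma bext_add: "f \<in> HV \<Longrightarrow> g \<in> HV \<Longrightarrow> bext (\<lambda>x. f x + g x) z = bext f z + bext g z"
  using sums_add[OF bext_sums[of f z] bext_sums[of g z]] bext_sums[OF HV_add, where f1 = f and g1 = g and z = z]
  by (simp add: bdir_pow_add add_divide_distrib sums_unique2)

lemma bext_cmult: "f \<in> HV \<Longrightarrow> bext (\<lambda>x. c * f x) z = c * bext f z"
  using sums_mult[OF bext_sums[of f z], of c] bext_sums[OF HV_cmult, of f z c]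
  by (simp add: bdir_pow_cmult sums_unique2)

text \<open>The Leibniz rule expands the powers of the derivation on a product into binomial sums,
  which \<open>exp_double_sums\<close> factors into two exponential series.\<close>

lemma bext_mult:
  assumes f: "f \<in> HV" and g: "g \<in> HV"
  shows "bext (\<lambda>x. f x * g x) z = bext f z * bext g z"
proof -
  define Q where "Q k l x = (bdir z ^^ k) f x * (bdir z ^^ l) g x" for k l x
  have QHV: "Q k l \<in> HV" for k l
    unfolding Q_def[abs_def] by (intro HV_mult bdir_pow_HV f g)
  have "(bdir z ^^ n) (Q 0 0) = (\<lambda>x. \<Sum>k\<le>n. of_nat (n choose k) * Q k (n - k) x)" for n
  proof (rule bdir_pow_binomial[OF QHV])
    show "bdir z (Q k l) = (\<lambda>x. Q (Suc k) l x + Q k (Suc l) x)" for k l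
      unfolding Q_def[abs_def] by (simp add: bdir_mult bdir_pow_HV f g)
  qed
  then have S: "(\<lambda>n. (\<Sum>k\<le>n. of_nat (n choose k) * Q k (n - k) 0) / fact n) sums bext (Q 0 0) z"
    using bext_sums[OF QHV[of 0 0], of z] by simp
  let ?a = "exp 1 * norm z / real 1"
  have "(\<lambda>l. (bext f z * (bdir z ^^ l) g 0) / fact l) sums bext (Q 0 0) z"
  proof (rule exp_double_sums[OF _ _ _ _ S])
    fix k l
    show "norm (Q k l 0) \<le> (HV_seminorm 1 f * HV_seminorm 1 g) * ?a ^ k * ?a ^ l"
    proof -
      have "norm (Q k l 0) \<le> (?a ^ k * HV_seminorm 1 f) * (?a ^ l * HV_seminorm 1 g)"
        unfolding Q_def norm_mult
        by (intro mult_mono norm_bdir_pow_0 f g mult_nonneg_nonneg HV_seminorm_nonneg) auto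
      then show ?thesis by (simp add: mult_ac)
    qed
    show "(\<lambda>k. Q k l 0 / fact k) sums (bext f z * (bdir z ^^ l) g 0)"
      using sums_mult2[OF bext_sums[OF f, of z], of "(bdir z ^^ l) g 0"] by (simp add: Q_def)
  qed auto
  moreover have "(\<lambda>l. (bext f z * (bdir z ^^ l) g 0) / fact l) sums (bext f z * bext g z)"
    using sums_mult[OF bext_sums[OF g, of z], of "bext f z"] by simp
  ultimately have "bext (Q 0 0) z = bext f z * bext g z" by (rule sums_unique2)
  then show ?thesis by (simp add: Q_def[abs_def])
qed

text \<open>\<open>bdir\<close> is additive in the direction and the two derivations commute, so the
  binomial theorem applies to \<open>bdir (z + w)\<close>; the double series is summed over the
  powers of \<open>bdir z\<close> first.\<close>

lemma bext_translate:
  fixes f :: "'a::complex_normed_vector \<Rightarrow> complex"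
  assumes ar: "Arens_symmetric TYPE('a)" and f: "f \<in> HV"
  shows "(\<lambda>l. bext ((bdir w ^^ l) f) z / fact l) sums bext f (z + w)"
proof -
  define Q where "Q k l = (bdir z ^^ k) ((bdir w ^^ l) f)" for k l
  have QHV: "Q k l \<in> HV" for k l unfolding Q_def by (intro bdir_pow_HV f)
  have "(bdir (z + w) ^^ n) (Q 0 0) = (\<lambda>x. \<Sum>k\<le>n. of_nat (n choose k) * Q k (n - k) x)" for n
  proof (rule bdir_pow_binomial[OF QHV])
    show "bdir (z + w) (Q k l) = (\<lambda>x. Q (Suc k) l x + Q k (Suc l) x)" for k l
      by (simp add: Q_def bdir_add_direction bdir_pow_commute[OF ar] bdir_pow_HV f)
  qed
  then have S: "(\<lambda>n. (\<Sum>k\<le>n. of_nat (n choose k) * Q k (n - k) 0) / fact n) sums bext f (z + w)"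
    using bext_sums[OF f, of "z + w"] by (simp add: Q_def)
  let ?a = "exp 1 * norm z / real 1" and ?b = "exp 1 * norm w / real 1"
  show ?thesis
  proof (rule exp_double_sums[OF _ _ _ _ S])
    fix k l
    have "norm (Q k l 0) \<le> ?a ^ k * HV_seminorm 1 ((bdir w ^^ l) f)"
      unfolding Q_def by (intro norm_bdir_pow_0 bdir_pow_HV f) simp
    also have "\<dots> \<le> ?a ^ k * (?b ^ l * HV_seminorm 1 f)"
      by (intro mult_left_mono HV_seminorm_bdir_pow f) auto
    finally show "norm (Q k l 0) \<le> HV_seminorm 1 f * ?a ^ k * ?b ^ l" by (simp add: mult_ac)
    show "(\<lambda>k. Q k l 0 / fact k) sums bext ((bdir w ^^ l) f) z"
      unfolding Q_def by (intro bext_sums bdir_pow_HV f)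
  qed auto
qed

text \<open>This is the tail of the translation series from the second power of
  \<open>bdir w\<close> on; \<open>norm w \<le> 1\<close> makes the constant independent of
  \<open>w\<close>.\<close>

lemma bext_linear_remainder:
  fixes f :: "'a::complex_normed_vector \<Rightarrow> complex"
  assumes ar: "Arens_symmetric TYPE('a)" and f: "f \<in> HV" and w: "norm w \<le> 1"
  shows "norm (bext f (z + w) - bext f z - bext (bdir w f) z)
    \<le> exp (exp 1 * norm z) * HV_seminorm 1 f * exp 1 ^ 2 * exp (exp 1) * norm w ^ 2"
proof -
  define b where "b = exp 1 * norm w"
  define C where "C = exp (exp 1 * norm z) * HV_seminorm 1 f"
  have C: "C \<ge> 0" using HV_seminorm_nonneg[OF f, of 1] by (simp add: C_def)
  have b: "0 \<le> b" "b \<le> exp 1" using w by (auto simp: b_def mult_left_le)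
  define a where "a l = bext ((bdir w ^^ l) f) z / fact l" for l
  have an: "norm (a l) \<le> C * (b ^ l / fact l)" for l
  proof -
    have "norm (bext ((bdir w ^^ l) f) z) \<le> exp (exp 1 * norm z / real 1) * HV_seminorm 1 ((bdir w ^^ l) f)"
      by (intro norm_bext_le bdir_pow_HV f) simp
    also have "\<dots> \<le> exp (exp 1 * norm z / real 1) * ((exp 1 * norm w / real 1) ^ l * HV_seminorm 1 f)"
      by (intro mult_left_mono HV_seminorm_bdir_pow f) auto
    finally have "norm (bext ((bdir w ^^ l) f) z) \<le> C * b ^ l" by (simp add: C_def b_def mult_ac)
    then show ?thesis by (simp add: a_def norm_divide divide_right_mono)
  qed
  have "a sums bext f (z + w)" unfolding a_def[abs_def] by (rule bext_translate[OF ar f])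
  then have "(\<lambda>l. a (l + 2)) sums (bext f (z + w) - sum a {..<2})" by (rule sums_split_initial_segment)
  moreover have "sum a {..<2} = bext f z + bext (bdir w f) z"
    by (simp add: a_def numeral_2_eq_2 lessThan_Suc add.commute)
  ultimately have s: "(\<lambda>l. a (l + 2)) sums (bext f (z + w) - bext f z - bext (bdir w f) z)"
    by (simp add: diff_diff_eq)
  have g: "(\<lambda>l. C * b ^ 2 * (b ^ l / fact l)) sums (C * b ^ 2 * exp b)"
    by (rule sums_mult[OF exp_sums_real])
  have "norm (\<Sum>l. a (l + 2)) \<le> (\<Sum>l. C * b ^ 2 * (b ^ l / fact l))"
  proof (rule norm_suminf_le[OF _ sums_summable[OF g]])
    fix l
    have "norm (a (l + 2)) \<le> C * (b ^ (l + 2) / fact (l + 2))" by (rule an)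
    also have "\<dots> \<le> C * (b ^ (l + 2) / fact l)"
      using C b by (intro mult_left_mono divide_left_mono fact_mono) auto
    finally show "norm (a (l + 2)) \<le> C * b ^ 2 * (b ^ l / fact l)"
      by (simp add: power_add power2_eq_square mult_ac)
  qed
  also have "\<dots> = C * b ^ 2 * exp b" using g by (simp add: sums_iff)
  also have "\<dots> \<le> C * b ^ 2 * exp (exp 1)" using C b by (intro mult_left_mono) auto
  finally show ?thesis using s by (simp add: sums_iff C_def b_def power_mult_distrib mult_ac)
qed

text \<open>The differential of the extension at \<open>z\<close> lies a priori in the third dual; it comes from the dual itself.\<close>

lemma bext_gradient:
  fixes f :: "'a::complex_normed_vector \<Rightarrow> complex"
  assumes ar: "Arens_symmetric TYPE('a)" and f: "f \<in> HV"
  obtains \<Gamma> where "\<And>w. cdual_apply w \<Gamma> = bext (bdir w f) z"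
proof -
  \<comment> \<open>The series of gradients at 0 converges absolutely in the dual. As
    \<open>bdir w\<close> commutes with \<open>bdir z\<close>, applying \<open>w\<close> termwise
    gives the series of \<open>bext (bdir w f) z\<close>.\<close>
  define G where "G n = (1 / fact n) *\<^sub>R grad ((bdir z ^^ n) f) 0" for n
  have G_le: "norm (G n) \<le> (exp 1 * norm z / real 1) ^ n / fact n * (exp 1 * HV_seminorm 1 f)" for n
  proof -
    have "norm (grad ((bdir z ^^ n) f) 0) \<le> exp 1 * HV_seminorm 1 ((bdir z ^^ n) f)"
      using norm_grad_HV_le[OF bdir_pow_HV[OF f, where z = z and n = n], of 1 0] by simp
    also have "\<dots> \<le> exp 1 * ((exp 1 * norm z / real 1) ^ n * HV_seminorm 1 f)"
      by (intro mult_left_mono HV_seminorm_bdir_pow f) auto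
    finally show ?thesis by (simp add: G_def field_simps)
  qed
  have "summable (\<lambda>n. (exp 1 * norm z / real 1) ^ n / fact n * (exp 1 * HV_seminorm 1 f))"
    by (intro summable_mult2 sums_summable[OF exp_sums_real])
  then have "summable G" by (rule summable_comparison_test') (rule G_le)
  then have G: "G sums suminf G" by (rule summable_sums)
  show thesis
  proof (rule that[of "suminf G"])
    fix w
    have "(\<lambda>n. cdual_apply w (G n)) sums cdual_apply w (suminf G)"
      by (rule bounded_linear.sums[OF bounded_linear_cdual_apply G])
    moreover have "cdual_apply w (G n) = (bdir z ^^ n) (bdir w f) 0 / fact n" for n
    proof -
      have "cdual_apply w (grad ((bdir z ^^ n) f) 0) = (bdir z ^^ n) (bdir w f) 0"
        using fun_cong[OF bdir_pow_commute[OF ar f, of w n z], of 0] by (simp add: bdir_def)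
      then show ?thesis by (simp add: G_def cdual_apply_arg_scaleR scaleR_conv_of_real)
    qed
    ultimately show "cdual_apply w (suminf G) = bext (bdir w f) z"
      using bext_sums[OF bdir_HV[OF f, of w], of z] by (simp add: sums_unique2)
  qed
qed

section \<open>From dual isomorphisms to algebra isomorphisms\<close>

lemma bdir_zero: "bdir 0 f = (\<lambda>x. 0)"
  by (simp add: bdir_def[abs_def] cdual_apply_zero)

lemma bext_zero: "bext f 0 = f 0"
proof -
  have "(bdir 0 ^^ n) f 0 / fact n = 0" if "n \<notin> {0}" for n
    using that by (cases n) (simp_all add: bdir_zero)
  then have "bext f 0 = (\<Sum>n\<in>{0}. (bdir 0 ^^ n) f 0 / fact n)"
    unfolding bext_def by (intro suminf_finite) auto
  then show ?thesis by simp
qed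

lemma deriv_pow_line:
  assumes f: "f \<in> HV"
  shows "(deriv ^^ n) (\<lambda>s. f (s *\<^sub>C x)) = (\<lambda>s. (bdir (bidual_embed x) ^^ n) f (s *\<^sub>C x))"
proof (induction n)
  case (Suc n)
  have "deriv (\<lambda>s. (bdir (bidual_embed x) ^^ n) f (s *\<^sub>C x)) s = bdir (bidual_embed x) ((bdir (bidual_embed x) ^^ n) f) (s *\<^sub>C x)" for s
    using grad_line[OF HV_holomorphic[OF bdir_pow_HV[OF f]], where x = 0 and u = x and s = s]
    by (intro DERIV_imp_deriv) (simp add: bdir_def)
  then show ?case using Suc by simp
qed simp

text \<open>For an embedded \<open>x\<close> the derivation is differentiation along the line
  through \<open>x\<close>, so the series is the Taylor series of \<open>f (s *\<^sub>C x)\<close>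
  at \<open>s = 1\<close>, a point inside the disc of radius 2.\<close>

lemma bext_embed:
  assumes f: "f \<in> HV"
  shows "bext f (bidual_embed x) = f x"
proof -
  have "(\<lambda>s. f (s *\<^sub>C x)) holomorphic_on ball 0 2"
    using grad_line[OF HV_holomorphic[OF f], where x = 0 and u = x] by (auto simp: holomorphic_on_open)
  from holomorphic_power_series[OF this, of 1]
  have "(\<lambda>n. (bdir (bidual_embed x) ^^ n) f 0 / fact n) sums f x"
    by (simp add: deriv_pow_line[OF f])
  then show ?thesis using bext_sums[OF f] sums_unique2 by blast
qed

text \<open>The adjoint of \<open>S\<close> sends embedded points of \<open>'b\<close> only into the
  bidual of \<open>'a\<close>, so \<open>f\<close> is replaced by its extension before
  composing.\<close>

definition transport ::
    "('a::complex_normed_vector cdual \<Rightarrow> 'b::complex_normed_vector cdual) \<Rightarrow> ('a \<Rightarrow> complex) \<Rightarrow> 'b \<Rightarrow> complex"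
  where "transport S f y = bext f (precomp (bidual_embed y) S)"

context
  fixes S :: "'a::complex_normed_vector cdual \<Rightarrow> 'b::complex_normed_vector cdual"
  assumes ar: "Arens_symmetric TYPE('a)" and S: "clinear S" "bounded_linear S"
begin

lemma adjoint_embed: "clinear (\<lambda>y. precomp (bidual_embed y) S)" "bounded_linear (\<lambda>y. precomp (bidual_embed y) S)"
  using clinear_compose[OF precomp_clinear_left(1)[OF S] bidual_embed_clinear(1)]
    bounded_linear_compose[OF precomp_clinear_left(2)[OF S] bidual_embed_clinear(2)] by auto

text \<open>By \<open>bext_gradient\<close> the differential of the extension is evaluation at some
  \<open>\<Gamma>\<close> in the dual, and composing with the adjoint turns \<open>\<Gamma>\<close>
  into \<open>S \<Gamma>\<close>. This form allows directions \<open>w\<close> from the whole bidual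
  in \<open>bdir_transport\<close>.\<close>

lemma transport_has_derivative:
  assumes f: "f \<in> HV"
  obtains \<Gamma> where "(transport S f has_derivative cdual_apply (S \<Gamma>)) (at y)"
    "\<And>w. cdual_apply w \<Gamma> = bext (bdir w f) (precomp (bidual_embed y) S)"
proof -
  let ?\<theta> = "\<lambda>y. precomp (bidual_embed y) S"
  obtain \<Gamma> where \<Gamma>: "\<And>w. cdual_apply w \<Gamma> = bext (bdir w f) (?\<theta> y)"
    using bext_gradient[OF ar f, of "?\<theta> y"] by metis
  obtain K where K: "K > 0" "\<And>h. norm (?\<theta> h) \<le> norm h * K"
    using bounded_linear.pos_bounded[OF adjoint_embed(2)] by blast
  define C where "C = exp (exp 1 * norm (?\<theta> y)) * HV_seminorm 1 f * exp 1 ^ 2 * exp (exp 1)"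
  have C: "C \<ge> 0" using HV_seminorm_nonneg[OF f, of 1] by (simp add: C_def)
  have "(transport S f has_derivative cdual_apply (S \<Gamma>)) (at y)"
  proof (rule has_derivative_quadratic_remainder[OF bounded_linear_cdual_apply])
    show "1 / K > 0" using K by simp
    fix h :: 'b assume h: "norm h \<le> 1 / K"
    have "norm h * K \<le> 1" using h K(1) by (simp add: field_simps)
    then have le1: "norm (?\<theta> h) \<le> 1" using K(2)[of h] by linarith
    have "cdual_apply (S \<Gamma>) h = bext (bdir (?\<theta> h) f) (?\<theta> y)"
      using \<Gamma>[of "?\<theta> h"] by (simp add: S)
    then have "norm (transport S f (y + h) - transport S f y - cdual_apply (S \<Gamma>) h) \<le> C * norm (?\<theta> h) ^ 2"
      using bext_linear_remainder[OF ar f le1, of "?\<theta> y"]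
      by (simp add: transport_def C_def clinear_add[OF adjoint_embed(1)])
    also have "\<dots> \<le> C * (norm h * K) ^ 2" using C K(2)[of h] by (intro mult_left_mono power_mono) auto
    finally show "norm (transport S f (y + h) - transport S f y - cdual_apply (S \<Gamma>) h) \<le> (C * K ^ 2) * norm h ^ 2"
      by (simp add: power_mult_distrib mult_ac)
  qed
  then show thesis using \<Gamma> by (rule that)
qed

lemma transport_bound:
  assumes n: "1 \<le> n"
  obtains m where "1 \<le> m"
    "\<And>f y. f \<in> HV \<Longrightarrow> norm (transport S f y) \<le> HV_seminorm m f * exp (norm y / real n)"
proof -
  obtain K where K: "K > 0" "\<And>h. norm (precomp (bidual_embed h) S) \<le> norm h * K"
    using bounded_linear.pos_bounded[OF adjoint_embed(2)] by blast
  \<comment> \<open>The larger index absorbs the bound \<open>K\<close> of the adjoint together with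
    the factor \<open>exp 1\<close> from \<open>norm_bext_le\<close>.\<close>
  define m where "m = Suc (nat \<lceil>exp 1 * K * real n\<rceil>)"
  have m: "1 \<le> m" "exp 1 * K * real n \<le> real m" by (simp add: m_def) (simp add: m_def; linarith)
  show thesis
  proof (rule that[OF m(1)])
    fix f :: "'a \<Rightarrow> complex" and y assume f: "f \<in> HV"
    have "exp 1 * norm (precomp (bidual_embed y) S) * real n \<le> exp 1 * (norm y * K) * real n"
      by (intro mult_right_mono mult_left_mono K) auto
    also have "\<dots> = (exp 1 * K * real n) * norm y" by (simp add: mult_ac)
    also have "\<dots> \<le> real m * norm y" by (intro mult_right_mono m) simp
    finally have le: "exp 1 * norm (precomp (bidual_embed y) S) / real m \<le> norm y / real n"
      using m(1) n by (simp add: field_simps)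
    have "norm (transport S f y) \<le> exp (exp 1 * norm (precomp (bidual_embed y) S) / real m) * HV_seminorm m f"
      unfolding transport_def by (rule norm_bext_le[OF f m(1)])
    also have "\<dots> \<le> exp (norm y / real n) * HV_seminorm m f"
      using le HV_seminorm_nonneg[OF f m(1)] by (intro mult_right_mono) auto
    finally show "norm (transport S f y) \<le> HV_seminorm m f * exp (norm y / real n)" by (simp add: mult_ac)
  qed
qed

lemma transport_HV:
  assumes f: "f \<in> HV" shows "transport S f \<in> HV"
  unfolding HV_iff
proof (intro conjI allI impI)
  show "holomorphic_fun (transport S f)"
    unfolding holomorphic_fun_def
  proof
    fix y
    show "\<exists>D. clinear D \<and> (transport S f has_derivative D) (at y)"
    proof (rule transport_has_derivative[OF f, of y])
      fix \<Gamma> assume "(transport S f has_derivative cdual_apply (S \<Gamma>)) (at y)"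
      then show ?thesis using clinear_cdual_apply by (intro exI conjI)
    qed
  qed
  fix n :: nat assume "1 \<le> n"
  then show "\<exists>C. \<forall>x. norm (transport S f x) \<le> C * exp (norm x / real n)"
    by (rule transport_bound) (use f in blast)
qed

lemma transport_seminorm:
  assumes "1 \<le> n"
  shows "\<exists>m\<ge>1. \<forall>f\<in>HV. HV_seminorm n (transport S f) \<le> HV_seminorm m f"
  by (rule transport_bound[OF assms]) (meson HV_seminorm_le)

lemma transport_add:
  "f \<in> HV \<Longrightarrow> g \<in> HV \<Longrightarrow> transport S (\<lambda>x. f x + g x) = (\<lambda>y. transport S f y + transport S g y)"
  and transport_cmult: "f \<in> HV \<Longrightarrow> transport S (\<lambda>x. c * f x) = (\<lambda>y. c * transport S f y)"
  and transport_mult: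
  "f \<in> HV \<Longrightarrow> g \<in> HV \<Longrightarrow> transport S (\<lambda>x. f x * g x) = (\<lambda>y. transport S f y * transport S g y)"
  by (simp_all add: transport_def[abs_def] bext_add bext_cmult bext_mult)

lemma transport_continuous: "continuous_map HV_topology HV_topology (transport S)"
proof (rule continuous_map_HV_I[OF transport_HV _ transport_seminorm])
  fix f g :: "'a \<Rightarrow> complex" assume "f \<in> HV" "g \<in> HV"
  then show "transport S (\<lambda>x. f x - g x) = (\<lambda>y. transport S f y - transport S g y)"
    using transport_add[of f "\<lambda>x. - 1 * g x"] HV_cmult[of g "- 1"] transport_cmult[of g "- 1"] by simp
qed

lemma bdir_transport:
  assumes f: "f \<in> HV"
  shows "bdir w (transport S f) = transport S (bdir (precomp w S) f)"
proof
  fix y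
  show "bdir w (transport S f) y = transport S (bdir (precomp w S) f) y"
  proof (rule transport_has_derivative[OF f, of y])
    fix \<Gamma> assume \<Gamma>: "(transport S f has_derivative cdual_apply (S \<Gamma>)) (at y)"
      "\<And>w. cdual_apply w \<Gamma> = bext (bdir w f) (precomp (bidual_embed y) S)"
    have "bdir w (transport S f) y = cdual_apply (precomp w S) \<Gamma>"
      by (simp add: bdir_def grad_eqI[OF \<Gamma>(1)] S)
    then show ?thesis by (simp add: \<Gamma>(2) transport_def)
  qed
qed

lemma bdir_pow_transport:
  assumes f: "f \<in> HV"
  shows "(bdir w ^^ n) (transport S f) = transport S ((bdir (precomp w S) ^^ n) f)"
  by (induction n) (simp_all add: bdir_transport bdir_pow_HV f)

text \<open>\<open>transport S\<close> intertwines all powers of the derivations and preserves the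
  value at 0, so the two exponential series agree term by term.\<close>

lemma bext_transport:
  assumes f: "f \<in> HV"
  shows "bext (transport S f) w = bext f (precomp w S)"
proof -
  have "transport S g 0 = g 0" for g
    by (simp add: transport_def clinear_zero[OF adjoint_embed(1)] bext_zero)
  then show ?thesis
    unfolding bext_def[of "transport S f"] bdir_pow_transport[OF f] by (simp add: bext_def)
qed

text \<open>\<open>bext_transport\<close> merges the two maps into the extension of \<open>f\<close>
  at the image of \<open>x\<close> under both adjoints; by \<open>RS\<close> this image is
  \<open>bidual_embed x\<close>.\<close>

lemma transport_inverse:
  assumes R: "clinear R" "bounded_linear R" and RS: "\<And>\<gamma>. R (S \<gamma>) = \<gamma>" and f: "f \<in> HV"
  shows "transport R (transport S f) = f"
proof
  fix x
  have "precomp (precomp (bidual_embed x) R) S = bidual_embed x"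
    by (simp add: cdual_eq_iff S R RS)
  then show "transport R (transport S f) x = f x"
    by (simp add: transport_def[of R] bext_transport[OF f] bext_embed[OF f])
qed

end

section \<open>Assembling the isomorphism of algebras\<close>

lemma dual_isomorphic_operators:
  assumes "dual_isomorphic TYPE('a::complex_normed_vector) TYPE('b::complex_normed_vector)"
  obtains S :: "'a::complex_normed_vector cdual \<Rightarrow> 'b::complex_normed_vector cdual" and R where
    "clinear S" "bounded_linear S" "clinear R" "bounded_linear R" "\<And>\<gamma>. R (S \<gamma>) = \<gamma>" "\<And>\<delta>. S (R \<delta>) = \<delta>"
proof -
  obtain S :: "'a cdual \<Rightarrow> 'b cdual" and R where S: "clinear S" and h: "homeomorphism UNIV UNIV S R"
    using assms unfolding dual_isomorphic_def by blast
  have RS: "R (S \<gamma>) = \<gamma>" and SR: "S (R \<delta>) = \<delta>" for \<gamma> \<delta>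
    using h by (auto simp: homeomorphism_def)
  have "clinear R"
  proof (rule clinearI)
    show "R (x + y) = R x + R y" for x y
      using clinear_add[OF S, of "R x" "R y"] by (metis RS SR)
    show "R (c *\<^sub>C x) = c *\<^sub>C R x" for c x
      using clinear_scaleC[OF S, of c "R x"] by (metis RS SR)
  qed
  moreover from this have "bounded_linear R"
    using h by (simp add: clinear_continuous_bounded homeomorphism_def)
  moreover have "bounded_linear S"
    using S h by (simp add: clinear_continuous_bounded homeomorphism_def)
  ultimately show thesis using that[of S R] S RS SR by simp
qed

theorem dual_isomorphic_imp_HV_isomorphic:
  assumes iso: "dual_isomorphic TYPE('a::complex_normed_vector) TYPE('b::complex_normed_vector)"
    and ar: "Arens_symmetric TYPE('a)" "Arens_symmetric TYPE('b)"
  shows "HV_isomorphic TYPE('a) TYPE('b)"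
proof (rule dual_isomorphic_operators[OF iso])
  fix S :: "'a cdual \<Rightarrow> 'b cdual" and R
  assume S: "clinear S" "bounded_linear S" and R: "clinear R" "bounded_linear R"
    and RS: "\<And>\<gamma>. R (S \<gamma>) = \<gamma>" and SR: "\<And>\<delta>. S (R \<delta>) = \<delta>"
  note inv = transport_inverse[OF ar(1) S R RS] transport_inverse[OF ar(2) R S SR]
  have "homeomorphic_maps HV_topology HV_topology (transport S) (transport R)"
    unfolding homeomorphic_maps_def
    using transport_continuous[OF ar(1) S] transport_continuous[OF ar(2) R] inv by simp
  then have "homeomorphic_map HV_topology HV_topology (transport S)"
    using homeomorphic_map_maps by blast
  moreover have "bij_betw (transport S) HV HV"
    by (rule bij_betw_byWitness[where f' = "transport R"])
      (use inv transport_HV[OF ar(1) S] transport_HV[OF ar(2) R] in auto)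
  ultimately have "HV_iso (transport S)"
    unfolding HV_iso_def
    using transport_add[OF ar(1) S] transport_cmult[OF ar(1) S] transport_mult[OF ar(1) S] by simp
  then show ?thesis unfolding HV_isomorphic_def by blast
qed

theorem theorem4p3:
  "(HV_isomorphic TYPE('a::complex_banach) TYPE('b::complex_banach)
      \<longrightarrow> dual_isomorphic TYPE('a) TYPE('b))
   \<and> ((symmetrically_regular_banach TYPE('a) \<and> symmetrically_regular_banach TYPE('b))
        \<or> regular_banach TYPE('a)
      \<longrightarrow> (HV_isomorphic TYPE('a) TYPE('b) \<longleftrightarrow> dual_isomorphic TYPE('a) TYPE('b)))"
proof (intro conjI impI iffI)
  assume reg: "(symmetrically_regular_banach TYPE('a) \<and> symmetrically_regular_banach TYPE('b))
      \<or> regular_banach TYPE('a)"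
    and iso: "dual_isomorphic TYPE('a) TYPE('b)"
  have "Arens_symmetric TYPE('a)"
    using reg regular_imp_symmetrically_regular symmetrically_regular_Arens by blast
  \<comment> \<open>If only the first space is assumed regular, the dual isomorphism itself carries
    the symmetry of extensions over to \<open>'b\<close>.\<close>
  moreover have "Arens_symmetric TYPE('b)"
    using reg
  proof
    assume "regular_banach TYPE('a)"
    note regular_dual_Arens[OF this]
    then show ?thesis by (rule dual_isomorphic_operators[OF iso])
  qed (use symmetrically_regular_Arens in blast)
  ultimately show "HV_isomorphic TYPE('a) TYPE('b)"
    by (rule dual_isomorphic_imp_HV_isomorphic[OF iso])
qed (rule HV_isomorphic_imp_dual_isomorphic, assumption)+

end
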